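(* Consider sensing $N_{\mathrm{tr}}\ge1$ line-of-sight targets, i.e. the sensing channel is $\mathbf{G}^{(\boldsymbol{\eta})}=\sum_{i=1}^{N_{\mathrm{tr}}}\alpha_i\mathbf{A}(\theta_i)$ with unknown real parameter vector $\boldsymbol{\eta}=(\mathrm{Re}\,\alpha_1,\dots,\mathrm{Re}\,\alpha_{N_{\mathrm{tr}}},\mathrm{Im}\,\alpha_1,\dots,\mathrm{Im}\,\alpha_{N_{\mathrm{tr}}},\theta_1,\dots,\theta_{N_{\mathrm{tr}}})\in\mathbb{R}^{3N_{\mathrm{tr}}}$, while communicating with $K\ge0$ users. Then the minimum numbers of beamformers with and without interference cancellation satisfy $$N_{\min}^{\mathrm{IC}}\le K+\left\lfloor\sqrt{\tfrac72N_{\mathrm{tr}}^2+\tfrac12N_{\mathrm{tr}}}\right\rfloor,\qquad N_{\min}^{\mathrm{NIC}}\le\left\lfloor\sqrt{K^2+\tfrac72N_{\mathrm{tr}}^2+\tfrac12N_{\mathrm{tr}}}\right\rfloor .$$ In particular, for sensing only ($K=0$) at most $\left\lfloor\sqrt{\tfrac72N_{\mathrm{tr}}^2+\tfrac12N_{\mathrm{tr}}}\right\rfloor$ beamformers are needed, and if $K\ge\tfrac74N_{\mathrm{tr}}^2+\tfrac14N_{\mathrm{tr}}$ then $N_{\min}^{\mathrm{NIC}}=K$.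
   Context: Integers $N_T,N_R,\Upsilon\ge1$; reals $\sigma^2>0$, $P>0$; fixed channel vectors $\mathbf{h}_1,\dots,\mathbf{h}_K\in\mathbb{C}^{N_T}$. $\mathbf{A}:\mathbb{R}\to\mathbb{C}^{N_R\times N_T}$ is a differentiable array-response function; $\alpha_i\in\mathbb{C}$ are path loss coefficients and $\theta_i\in\mathbb{R}$ angles of arrival. Put $L=3N_{\mathrm{tr}}$. Beamformers: for $N\ge K$, a beamforming matrix with $N$ beamformers is $\mathbf{V}=[\mathbf{v}_1,\dots,\mathbf{v}_K,\mathbf{V}_s]\in\mathbb{C}^{N_T\times N}$, with communication beamformers $\mathbf{v}_k\in\mathbb{C}^{N_T}$ and sensing beamformers $\mathbf{V}_s\in\mathbb{C}^{N_T\times(N-K)}$. Bayesian Fisher information matrix (BFIM): $\boldsymbol{\eta}$ is random with prior density $f$ (all expectations below are assumed to exist). The BFIM is $\mathbf{J}_{\mathbf{V}}=\mathbf{C}+\mathbf{T}_{\mathbf{V}}\in\mathbb{R}^{L\times L}$, where $[\mathbf{C}]_{ij}=-\mathbb{E}[\partial^2\log f(\boldsymbol{\eta})/\partial\eta_i\partial\eta_j]$ and $[\mathbf{T}_{\mathbf{V}}]_{ij}=\frac{\Upsilon}{\sigma^2}\mathrm{tr}(\tilde{\mathbf{G}}_{ij}\mathbf{V}\mathbf{V}^{H})$ with $\tilde{\mathbf{G}}_{ij}=\mathbb{E}[\dot{\mathbf{G}}_i^{H}\dot{\mathbf{G}}_j+\dot{\mathbf{G}}_j^{H}\dot{\mathbf{G}}_i]$,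 $\dot{\mathbf{G}}_i=\partial\mathbf{G}^{(\boldsymbol{\eta})}/\partial\eta_i$. SINRs with (IC) and without (NIC) cancellation of interference from the sensing beams: $\mathrm{SINR}^{\mathrm{IC}}_{k,\mathbf{V}}=\dfrac{|\mathbf{h}_k^{H}\mathbf{v}_k|^2}{\sum_{i\ne k}|\mathbf{h}_k^{H}\mathbf{v}_i|^2+\sigma^2}$, $\quad\mathrm{SINR}^{\mathrm{NIC}}_{k,\mathbf{V}}=\dfrac{|\mathbf{h}_k^{H}\mathbf{v}_k|^2}{\sum_{i\ne k}|\mathbf{h}_k^{H}\mathbf{v}_i|^2+\mathbf{h}_k^{H}\mathbf{V}_s\mathbf{V}_s^{H}\mathbf{h}_k+\sigma^2}$. Minimum number of beamformers: let $h$ be a real function on $L\times L$ positive semidefinite matrices that is nondecreasing in the Loewner order, and let $\gamma_k>0$ be given SINR targets. For $\bullet\in\{\mathrm{IC},\mathrm{NIC}\}$ and $N\ge K$ let $p_N^{*}$ be the optimal value of: minimize $h(\mathbf{J}_{\mathbf{V}}^{-1})$ over $\mathbf{V}\in\mathbb{C}^{N_T\times N}$ subject to $\mathrm{SINR}^{\bullet}_{k,\mathbf{V}}\ge\gamma_k$ for all $k$ and $\mathrm{tr}(\mathbf{V}\mathbf{V}^{H})\le P$ (the constraints are assumed strictly feasible). $N_{\min}^{\bullet}$ is the smallest $N\ge K$ with $p_N^*=p_{N_T+K}^*$. *)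

theory Defs
  imports "HOL-Probability.Probability"
begin

section \<open>Linear algebra\<close>

definition conj_transpose :: "complex^'n^'m \<Rightarrow> complex^'m^'n" where
  "conj_transpose A = (\<chi> i j. cnj (A $ j $ i))"

definition herm_prod :: "complex^'n \<Rightarrow> complex^'n \<Rightarrow> complex" where
  "herm_prod x y = (\<Sum>a\<in>UNIV. cnj (x $ a) * y $ a)"

definition psd :: "real^'l^'l \<Rightarrow> bool" where
  "psd A \<longleftrightarrow> transpose A = A \<and> (\<forall>x. 0 \<le> x \<bullet> (A *v x))"

definition loewner_le :: "real^'l^'l \<Rightarrow> real^'l^'l \<Rightarrow> bool" where
  "loewner_le A B \<longleftrightarrow> psd (B - A)"

section \<open>Beamformers\<close>

text \<open>
  A beamforming matrix with \<open>N\<close> columns is represented by its sequence of columns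
  \<open>V :: nat \<Rightarrow> complex^'nt\<close>, of which only \<open>V 0, \<dots>, V (N - 1)\<close> are ever used: the columns
  with index in \<open>{..<K}\<close> are the communication beamformers and those with index in
  \<open>{K..<N}\<close> the sensing beamformers. For a set \<open>I\<close> of column indices, \<open>col_gram I V\<close> is
  the product of the submatrix with columns in \<open>I\<close> and its conjugate transpose.
\<close>

definition col_gram :: "nat set \<Rightarrow> (nat \<Rightarrow> complex^'nt) \<Rightarrow> complex^'nt^'nt" where
  "col_gram I V = (\<chi> a b. \<Sum>i\<in>I. V i $ a * cnj (V i $ b))"

section \<open>Bayesian Fisher information matrix\<close>

definition partial :: "'l \<Rightarrow> (real^'l \<Rightarrow> 'b::real_normed_vector) \<Rightarrow> real^'l \<Rightarrow> 'b" where
  "partial i g x = vector_derivative (\<lambda>t. g (x + t *\<^sub>R axis i 1)) (at 0)"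

definition partial_exists :: "'l \<Rightarrow> (real^'l \<Rightarrow> 'b::real_normed_vector) \<Rightarrow> real^'l \<Rightarrow> bool" where
  "partial_exists i g x \<longleftrightarrow> (\<lambda>t. g (x + t *\<^sub>R axis i 1)) differentiable (at 0)"

definition prior :: "(real^'l \<Rightarrow> real) \<Rightarrow> (real^'l) measure" where
  "prior f = density lborel (\<lambda>x. ennreal (f x))"

definition log_hess :: "(real^'l \<Rightarrow> real) \<Rightarrow> 'l \<Rightarrow> 'l \<Rightarrow> real^'l \<Rightarrow> real" where
  "log_hess f i j = partial i (partial j (\<lambda>x. ln (f x)))"

definition log_hess_exists :: "(real^'l \<Rightarrow> real) \<Rightarrow> 'l \<Rightarrow> 'l \<Rightarrow> real^'l \<Rightarrow> bool" where
  "log_hess_exists f i j x \<longleftrightarrow>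
     (\<forall>\<^sub>F t in nhds 0. partial_exists j (\<lambda>y. ln (f y)) (x + t *\<^sub>R axis i 1)) \<and>
     partial_exists i (partial j (\<lambda>y. ln (f y))) x"

definition cross_gram ::
  "(real^'l \<Rightarrow> complex^'nt^'nr) \<Rightarrow> 'l \<Rightarrow> 'l \<Rightarrow> real^'l \<Rightarrow> complex^'nt^'nt" where
  "cross_gram G i j x =
     conj_transpose (partial i G x) ** partial j G x +
     conj_transpose (partial j G x) ** partial i G x"

definition bfim_expectations_exist ::
  "(real^'l \<Rightarrow> real) \<Rightarrow> (real^'l \<Rightarrow> complex^'nt^'nr) \<Rightarrow> bool" where
  "bfim_expectations_exist f G \<longleftrightarrow>
     (\<forall>i j. (AE x in prior f. log_hess_exists f i j x) \<and>
            integrable (prior f) (log_hess f i j) \<and>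
            integrable (prior f) (cross_gram G i j))"

text \<open>
  The trace below is a real number, because \<open>cross_gram\<close> and \<open>col_gram\<close> are Hermitian;
  \<open>Re\<close> only changes its type. The parameter \<open>s2\<close> stands for \<open>\<sigma>\<^sup>2\<close>.
\<close>

definition bfim ::
  "nat \<Rightarrow> real \<Rightarrow> (real^'l \<Rightarrow> real) \<Rightarrow> (real^'l \<Rightarrow> complex^'nt^'nr) \<Rightarrow>
   nat \<Rightarrow> (nat \<Rightarrow> complex^'nt) \<Rightarrow> real^'l^'l" where
  "bfim \<Upsilon> s2 f G N V = (\<chi> i j.
     - (\<integral>x. log_hess f i j x \<partial>prior f) +
     real \<Upsilon> / s2 * Re (trace ((\<integral>x. cross_gram G i j x \<partial>prior f) ** col_gram {..<N} V)))"

section \<open>SINR constraints and the minimum number of beamformers\<close>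

datatype cancellation = IC | NIC

fun sinr ::
  "cancellation \<Rightarrow> (nat \<Rightarrow> complex^'nt) \<Rightarrow> nat \<Rightarrow> real \<Rightarrow>
   nat \<Rightarrow> (nat \<Rightarrow> complex^'nt) \<Rightarrow> nat \<Rightarrow> real" where
  "sinr IC H K s2 N V k =
     (cmod (herm_prod (H k) (V k)))\<^sup>2 /
     ((\<Sum>i\<in>{..<K} - {k}. (cmod (herm_prod (H k) (V i)))\<^sup>2) + s2)"
| "sinr NIC H K s2 N V k =
     (cmod (herm_prod (H k) (V k)))\<^sup>2 /
     ((\<Sum>i\<in>{..<K} - {k}. (cmod (herm_prod (H k) (V i)))\<^sup>2)
      + Re (herm_prod (H k) (col_gram {K..<N} V *v H k)) + s2)"

definition feasible ::
  "cancellation \<Rightarrow> (nat \<Rightarrow> complex^'nt) \<Rightarrow> nat \<Rightarrow> real \<Rightarrow> (nat \<Rightarrow> real) \<Rightarrow> real \<Rightarrow>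
   nat \<Rightarrow> (nat \<Rightarrow> complex^'nt) set" where
  "feasible m H K s2 \<gamma> P N =
     {V. (\<forall>k<K. sinr m H K s2 N V k \<ge> \<gamma> k) \<and> Re (trace (col_gram {..<N} V)) \<le> P}"

definition strictly_feasible ::
  "cancellation \<Rightarrow> (nat \<Rightarrow> complex^'nt) \<Rightarrow> nat \<Rightarrow> real \<Rightarrow> (nat \<Rightarrow> real) \<Rightarrow> real \<Rightarrow>
   nat \<Rightarrow> bool" where
  "strictly_feasible m H K s2 \<gamma> P N \<longleftrightarrow>
     (\<exists>V. (\<forall>k<K. sinr m H K s2 N V k > \<gamma> k) \<and> Re (trace (col_gram {..<N} V)) < P)"

text \<open>
  The objective \<open>h (J\<^sup>-\<^sup>1)\<close> is only meaningful if \<open>J\<close> is invertible and its inverse lies in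
  the domain of \<open>h\<close>, the positive semidefinite matrices. As usual in minimization, its
  value outside this domain is infinite.
\<close>

definition objective :: "(real^'l^'l \<Rightarrow> real) \<Rightarrow> real^'l^'l \<Rightarrow> ereal" where
  "objective h J =
     (if invertible J \<and> psd (matrix_inv J) then ereal (h (matrix_inv J)) else \<infinity>)"

definition opt_value ::
  "cancellation \<Rightarrow> (nat \<Rightarrow> complex^'nt) \<Rightarrow> nat \<Rightarrow> real \<Rightarrow> (nat \<Rightarrow> real) \<Rightarrow> real \<Rightarrow>
   nat \<Rightarrow> (real^'l \<Rightarrow> real) \<Rightarrow> (real^'l \<Rightarrow> complex^'nt^'nr) \<Rightarrow> (real^'l^'l \<Rightarrow> real) \<Rightarrow>
   nat \<Rightarrow> ereal" where
  "opt_value m H K s2 \<gamma> P \<Upsilon> f G h N =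
     (INF V\<in>feasible m H K s2 \<gamma> P N. objective h (bfim \<Upsilon> s2 f G N V))"

definition min_beamformers ::
  "cancellation \<Rightarrow> (nat \<Rightarrow> complex^'nt) \<Rightarrow> nat \<Rightarrow> real \<Rightarrow> (nat \<Rightarrow> real) \<Rightarrow> real \<Rightarrow>
   nat \<Rightarrow> (real^'l \<Rightarrow> real) \<Rightarrow> (real^'l \<Rightarrow> complex^'nt^'nr) \<Rightarrow> (real^'l^'l \<Rightarrow> real) \<Rightarrow>
   nat" where
  "min_beamformers m H K s2 \<gamma> P \<Upsilon> f G h =
     (LEAST N. K \<le> N \<and>
        opt_value m H K s2 \<gamma> P \<Upsilon> f G h N = opt_value m H K s2 \<gamma> P \<Upsilon> f G h (CARD('nt) + K))"

section \<open>Line-of-sight sensing channel\<close>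

text \<open>
  The targets are indexed by the finite type \<open>'tr\<close>, and the three summands of the index
  type of the parameter vector address the real parts of the path losses, their
  imaginary parts and the angles, in this order.
\<close>

type_synonym 'tr los = "'tr + 'tr + 'tr"

definition path_loss :: "real^('tr::finite los) \<Rightarrow> 'tr \<Rightarrow> complex" where
  "path_loss \<eta> i = Complex (\<eta> $ Inl i) (\<eta> $ Inr (Inl i))"

definition angle_of_arrival :: "real^('tr::finite los) \<Rightarrow> 'tr \<Rightarrow> real" where
  "angle_of_arrival \<eta> i = \<eta> $ Inr (Inr i)"

definition los_channel ::
  "(real \<Rightarrow> complex^'nt^'nr) \<Rightarrow> real^('tr::finite los) \<Rightarrow> complex^'nt^'nr" where
  "los_channel A \<eta> =
     (\<chi> a b. \<Sum>i\<in>UNIV. path_loss \<eta> i * A (angle_of_arrival \<eta> i) $ a $ b)"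

end

theory Submission
  imports Defs
begin

text \<open>
  The information matrix depends on \<open>V\<close> only through \<open>7/2 N\<^sub>t\<^sub>r\<^sup>2 + 1/2 N\<^sub>t\<^sub>r\<close> real linear functionals
  of \<open>V V\<^sup>H\<close>, because the derivatives in the real and imaginary parts of a path loss differ only by the
  factor \<open>\<i>\<close>. If \<open>V\<close> has enough columns, there is a nonzero Hermitian \<open>D\<close> such that all
  these functionals vanish at \<open>V D V\<^sup>H\<close>, and the sign of \<open>D\<close> can be chosen so that
  \<open>tr (V D V\<^sup>H) \<le> 0\<close> and \<open>D\<close> has a negative eigenvalue. Increase \<open>t\<close> until
  \<open>1 + t D\<close> becomes singular: then \<open>V (1 + t D) V\<^sup>H\<close> factors with one column fewer, carries the same
  information and needs no more power.

  With interference cancellation this is applied to the sensing columns alone, whose \<open>D\<close> range over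
  \<open>(N - K)\<^sup>2\<close> real dimensions. Without it, \<open>V\<close> is first multiplied by a unitary matrix that makes
  the sensing columns invisible to all users and lowers no SINR. Then every \<open>D\<close> whose communication block vanishes
  is allowed, which gives \<open>N\<^sup>2 - K\<^sup>2\<close> dimensions: a Cholesky factorization of \<open>1 + t D\<close> changes the
  communication columns only by combinations of sensing columns, which the users do not see.
\<close>

section \<open>Hermitian forms over a finite index set\<close>

text \<open>Gaussian elimination by induction on the equations: \<open>e\<close> is solved for an
  unknown \<open>y\<close> with nonzero coefficient and substituted into the others.\<close>

lemma linear_system_nontrivial_solution:
  fixes a :: "'e \<Rightarrow> 'x \<Rightarrow> 'k::field"
  assumes "finite E" "finite X" "card E < card X"
  shows "\<exists>c. (\<exists>x\<in>X. c x \<noteq> 0) \<and> (\<forall>e\<in>E. (\<Sum>x\<in>X. c x * a e x) = 0)"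
  using assms
proof (induction E arbitrary: X a rule: finite_induct)
  case empty
  then obtain x where "x \<in> X" by fastforce
  then show ?case by (intro exI[of _ "\<lambda>_. 1"]) auto
next
  case (insert e E)
  show ?case
  proof (cases "\<forall>x\<in>X. a e x = 0")
    case True
    obtain c where "\<exists>x\<in>X. c x \<noteq> 0" "\<forall>e\<in>E. (\<Sum>x\<in>X. c x * a e x) = 0"
      using insert.IH[of X a] insert.prems insert.hyps by auto
    with True show ?thesis by (intro exI[of _ c]) auto
  next
    case False
    then obtain y where y: "y \<in> X" "a e y \<noteq> 0" by auto
    let ?X = "X - {y}"
    have "card E < card ?X" using insert.prems insert.hyps y by simp
    then obtain c where c: "\<exists>x\<in>?X. c x \<noteq> 0"
      "\<forall>e'\<in>E. (\<Sum>x\<in>?X. c x * (a e' x - a e x / a e y * a e' y)) = 0"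
      using insert.IH[of ?X "\<lambda>e' x. a e' x - a e x / a e y * a e' y"] insert.prems by auto
    define d where "d = c(y := - (\<Sum>x\<in>?X. c x * a e x) / a e y)"
    have split: "(\<Sum>x\<in>X. d x * a e' x) =
      (\<Sum>x\<in>?X. c x * a e' x) - (\<Sum>x\<in>?X. c x * a e x) / a e y * a e' y" for e'
    proof -
      have "(\<Sum>x\<in>X. d x * a e' x) = d y * a e' y + (\<Sum>x\<in>?X. d x * a e' x)"
        using insert.prems y by (simp add: sum.remove)
      also have "(\<Sum>x\<in>?X. d x * a e' x) = (\<Sum>x\<in>?X. c x * a e' x)"
        by (rule sum.cong) (auto simp: d_def)
      finally show ?thesis by (simp add: d_def)
    qed
    have "(\<Sum>x\<in>X. d x * a e' x) = 0" if "e' \<in> insert e E" for e'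
    proof (cases "e' = e")
      case True then show ?thesis unfolding split using y by simp
    next
      case False
      with that have "(\<Sum>x\<in>?X. c x * (a e' x - a e x / a e y * a e' y)) = 0" using c by blast
      then show ?thesis unfolding split
        by (simp add: algebra_simps sum_subtractf sum_distrib_left sum_distrib_right sum_divide_distrib)
    qed
    moreover have "\<exists>x\<in>X. d x \<noteq> 0" using c(1) by (auto simp: d_def)
    ultimately show ?thesis by blast
  qed
qed

text \<open>Matrices are functions restricted to an index set, not values of a matrix type, because
  the number of columns varies.\<close>

definition hermitian_on :: "'i set \<Rightarrow> ('i \<Rightarrow> 'i \<Rightarrow> complex) \<Rightarrow> bool" where
  "hermitian_on I S \<longleftrightarrow> (\<forall>p\<in>I. \<forall>q\<in>I. S q p = cnj (S p q))"

lemma hermitian_onD: "hermitian_on I S \<Longrightarrow> p \<in> I \<Longrightarrow> q \<in> I \<Longrightarrow> S q p = cnj (S p q)"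
  unfolding hermitian_on_def by blast

lemma hermitian_onI: "(\<And>p q. p \<in> I \<Longrightarrow> q \<in> I \<Longrightarrow> S q p = cnj (S p q)) \<Longrightarrow> hermitian_on I S"
  unfolding hermitian_on_def by blast

text \<open>For Hermitian \<open>S\<close> the double sum is already real; \<open>Re\<close> only
  changes its type.\<close>

definition qform :: "'i set \<Rightarrow> ('i \<Rightarrow> 'i \<Rightarrow> complex) \<Rightarrow> ('i \<Rightarrow> complex) \<Rightarrow> real" where
  "qform I S x = Re (\<Sum>p\<in>I. \<Sum>q\<in>I. cnj (x p) * S p q * x q)"

definition psd_on :: "'i set \<Rightarrow> ('i \<Rightarrow> 'i \<Rightarrow> complex) \<Rightarrow> bool" where
  "psd_on I S \<longleftrightarrow> hermitian_on I S \<and> (\<forall>x. 0 \<le> qform I S x)"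

text \<open>A real basis of the Hermitian matrices with one element per ordered pair: increasing
  pairs give real symmetric units, decreasing pairs imaginary antisymmetric ones.\<close>

definition hermitian_unit :: "'i::linorder \<times> 'i \<Rightarrow> 'i \<Rightarrow> 'i \<Rightarrow> complex" where
  "hermitian_unit x p q = (if fst x \<le> snd x
     then of_bool (p = fst x \<and> q = snd x) + of_bool (p = snd x \<and> q = fst x)
     else \<i> * (of_bool (p = fst x \<and> q = snd x) - of_bool (p = snd x \<and> q = fst x)))"

lemma hermitian_unit_cnj: "hermitian_unit x q p = cnj (hermitian_unit x p q)"
proof -
  have b: "cnj (of_bool P) = of_bool P" for P by (cases P) auto
  have c: "(q = a \<and> p = b) = (p = b \<and> q = a)" for a b by blast
  show ?thesis
    unfolding hermitian_unit_def c if_distrib[of cnj] complex_cnj_mult complex_cnj_diff complex_cnj_add b complex_cnj_i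
    by (simp only: minus_diff_eq mult_minus_left mult_minus_right minus_mult_left[symmetric] add.commute) 
     (simp add: algebra_simps)
qed

lemma hermitian_unit_eq_0: "x \<noteq> (p, q) \<Longrightarrow> x \<noteq> (q, p) \<Longrightarrow> hermitian_unit x p q = 0"
proof -
  assume "x \<noteq> (p, q)" "x \<noteq> (q, p)"
  then have *: "\<not> (p = fst x \<and> q = snd x)" "\<not> (p = snd x \<and> q = fst x)"
    by (metis prod.collapse)+
  show ?thesis unfolding hermitian_unit_def using * by (simp only: of_bool_eq if_cancel, simp)
qed

lemma hermitian_unit_simps:
  "hermitian_unit (a, a) a a = 2"
  "a \<noteq> b \<Longrightarrow> hermitian_unit (a, b) a b = (if a \<le> b then 1 else \<i>)"
  "a \<noteq> b \<Longrightarrow> hermitian_unit (b, a) a b = (if b \<le> a then 1 else - \<i>)"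
  by (simp_all add: hermitian_unit_def)
text \<open>The units indexed by \<open>I \<times> I - A \<times> A\<close> span a space of real
  dimension \<open>(card I)\<^sup>2 - (card A)\<^sup>2\<close>, on which each element of
  \<open>E\<close> imposes one real linear equation.\<close>

lemma hermitian_kernel:
  fixes A I :: "'i::linorder set" and F :: "'e \<Rightarrow> 'i \<Rightarrow> 'i \<Rightarrow> complex"
  assumes "finite I" "A \<subseteq> I" "finite E" "card E + (card A)\<^sup>2 < (card I)\<^sup>2"
  shows "\<exists>D. hermitian_on I D \<and> (\<exists>p\<in>I. \<exists>q\<in>I. D p q \<noteq> 0) \<and> (\<forall>p\<in>A. \<forall>q\<in>A. D p q = 0) \<and>
     (\<forall>e\<in>E. Re (\<Sum>p\<in>I. \<Sum>q\<in>I. D p q * F e p q) = 0)"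
proof -
  define X where "X = I \<times> I - A \<times> A"
  have finA: "finite A" using assms finite_subset by blast
  have finX: "finite X" using assms by (simp add: X_def)
  have "card X = (card I)\<^sup>2 - (card A)\<^sup>2"
    unfolding X_def using assms finA
    by (subst card_Diff_subset) (auto simp: card_cartesian_product power2_eq_square)
  then have "card E < card X" using assms by simp
  then obtain c where c: "\<exists>x\<in>X. c x \<noteq> 0"
     "\<forall>e\<in>E. (\<Sum>x\<in>X. c x * Re (\<Sum>p\<in>I. \<Sum>q\<in>I. hermitian_unit x p q * F e p q)) = 0"
    using linear_system_nontrivial_solution[OF assms(3) finX,
       of "\<lambda>e x. Re (\<Sum>p\<in>I. \<Sum>q\<in>I. hermitian_unit x p q * F e p q)"] by auto
  define D where "D = (\<lambda>p q. \<Sum>x\<in>X. complex_of_real (c x) * hermitian_unit x p q)"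
  have herm: "D q p = cnj (D p q)" for p q
    unfolding D_def cnj_sum by (intro sum.cong refl) (simp add: hermitian_unit_cnj[of _ q p])
  have "(\<Sum>p\<in>I. \<Sum>q\<in>I. D p q * F e p q) =
      (\<Sum>x\<in>X. complex_of_real (c x) * (\<Sum>p\<in>I. \<Sum>q\<in>I. hermitian_unit x p q * F e p q))" for e
  proof -
    have "(\<Sum>p\<in>I. \<Sum>q\<in>I. D p q * F e p q) =
      (\<Sum>p\<in>I. \<Sum>q\<in>I. \<Sum>x\<in>X. complex_of_real (c x) * (hermitian_unit x p q * F e p q))"
      by (simp add: D_def sum_distrib_left sum_distrib_right mult.assoc)
    also have "\<dots> = (\<Sum>p\<in>I. \<Sum>x\<in>X. \<Sum>q\<in>I. complex_of_real (c x) * (hermitian_unit x p q * F e p q))"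
      by (intro sum.cong refl sum.swap)
    also have "\<dots> = (\<Sum>x\<in>X. \<Sum>p\<in>I. \<Sum>q\<in>I. complex_of_real (c x) * (hermitian_unit x p q * F e p q))"
      by (rule sum.swap)
    finally show ?thesis by (simp add: sum_distrib_left)
  qed
  then have ker: "\<forall>e\<in>E. Re (\<Sum>p\<in>I. \<Sum>q\<in>I. D p q * F e p q) = 0"
    using c(2) by simp
  have "hermitian_unit x p q = 0" if "x \<in> X" "p \<in> A" "q \<in> A" for x p q
    using that by (intro hermitian_unit_eq_0) (auto simp: X_def)
  then have zero: "\<forall>p\<in>A. \<forall>q\<in>A. D p q = 0" by (simp add: D_def)
  \<comment> \<open>Towards independence of the units: only the units of the pairs
    \<open>(p, q)\<close> and \<open>(q, p)\<close> contribute to this entry.\<close>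
  have val: "D p q = (\<Sum>x\<in>X \<inter> {(p,q),(q,p)}. complex_of_real (c x) * hermitian_unit x p q)" for p q
    unfolding D_def
    by (rule sum.mono_neutral_right) (use finX hermitian_unit_eq_0[of _ p q] in auto)
  have "\<exists>p\<in>I. \<exists>q\<in>I. D p q \<noteq> 0"
  proof -
    obtain a b where ab: "(a, b) \<in> X" "c (a, b) \<noteq> 0" using c(1) by auto
    then have ba: "(b, a) \<in> X" by (auto simp: X_def)
    have "D a b \<noteq> 0"
    proof (cases "a = b")
      case True
      then show ?thesis using ab by (simp add: val hermitian_unit_simps)
    next
      case False
      then have X: "X \<inter> {(a,b),(b,a)} = {(a,b),(b,a)}" and "(a,b) \<noteq> (b,a)" using ab ba by auto
      then have "D a b = complex_of_real (c (a,b)) * hermitian_unit (a,b) a b +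
         complex_of_real (c (b,a)) * hermitian_unit (b,a) a b"
        by (simp add: val X)
      \<comment> \<open>One contribution is real and the other imaginary, so they cannot
        cancel.\<close>
      then show ?thesis using False ab(2)
        by (cases "a \<le> b"; cases "b \<le> a") (auto simp: hermitian_unit_simps complex_eq_iff)
    qed
    then show ?thesis using ab(1) by (auto simp: X_def)
  qed
  then show ?thesis using herm zero ker
    by (intro exI[of _ D] conjI hermitian_onI) blast+
qed

section \<open>Positive semidefinite forms, elimination and Cholesky factorization\<close>

lemma cnj_mult_self: "cnj z * z = of_real ((cmod z)\<^sup>2)"
  by (metis complex_norm_square mult.commute)

text \<open>Quadratic expansion in one coordinate. With \<open>x = 0\<close> and
  \<open>c = 1\<close> it reads off a diagonal entry; with the optimal \<open>c\<close> it completes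
  the square.\<close>

lemma qform_update:
  assumes "finite I" "a \<in> I" "hermitian_on I S"
  shows "qform I S (\<lambda>p. x p + (if p = a then c else 0)) =
     qform I S x + 2 * Re (cnj c * (\<Sum>q\<in>I. S a q * x q)) + (cmod c)\<^sup>2 * Re (S a a)"
proof -
  let ?d = "\<lambda>p. if p = a then c else 0"
  have "(\<Sum>p\<in>I. \<Sum>q\<in>I. cnj (x p + ?d p) * S p q * (x q + ?d q)) =
     (\<Sum>p\<in>I. \<Sum>q\<in>I. cnj (x p) * S p q * x q) + (\<Sum>p\<in>I. \<Sum>q\<in>I. cnj (?d p) * S p q * x q)
     + (\<Sum>p\<in>I. \<Sum>q\<in>I. cnj (x p) * S p q * ?d q) + (\<Sum>p\<in>I. \<Sum>q\<in>I. cnj (?d p) * S p q * ?d q)"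
    by (simp only: sum.distrib[symmetric]) (intro sum.cong refl, simp add: algebra_simps)
  also have "(\<Sum>p\<in>I. \<Sum>q\<in>I. cnj (?d p) * S p q * x q) = cnj c * (\<Sum>q\<in>I. S a q * x q)"
  proof -
    have "(\<Sum>p\<in>I. \<Sum>q\<in>I. cnj (?d p) * S p q * x q) = (\<Sum>p\<in>I. if p = a then (\<Sum>q\<in>I. cnj c * S a q * x q) else 0)"
      by (intro sum.cong refl) auto
    then show ?thesis using assms by (simp add: sum_distrib_left mult.assoc)
  qed
  also have "(\<Sum>p\<in>I. \<Sum>q\<in>I. cnj (x p) * S p q * ?d q) = cnj (cnj c * (\<Sum>q\<in>I. S a q * x q))"
  proof -
    have "(\<Sum>p\<in>I. \<Sum>q\<in>I. cnj (x p) * S p q * ?d q) = (\<Sum>p\<in>I. cnj (x p) * S p a * c)"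
      using assms by (intro sum.cong refl) (simp add: if_distrib sum.delta cong: if_cong)
    also have "\<dots> = (\<Sum>p\<in>I. c * cnj (S a p) * cnj (x p))"
      by (intro sum.cong refl) (simp add: hermitian_onD[OF assms(3,2)])
    finally show ?thesis by (simp add: sum_distrib_left mult.assoc)
  qed
  also have "(\<Sum>p\<in>I. \<Sum>q\<in>I. cnj (?d p) * S p q * ?d q) = cnj c * c * S a a"
  proof -
    have "(\<Sum>p\<in>I. \<Sum>q\<in>I. cnj (?d p) * S p q * ?d q) = (\<Sum>p\<in>I. if p = a then (\<Sum>q\<in>I. if q = a then cnj c * S a a * c else 0) else 0)"
      by (intro sum.cong refl) (auto intro!: sum.cong)
    then show ?thesis using assms by simp
  qed
  also have "cnj c * c = of_real ((cmod c)\<^sup>2)" by (rule cnj_mult_self)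
  finally show ?thesis
    unfolding qform_def by (simp del: of_real_power cnj_sum complex_cnj_mult)
qed

lemma psd_on_diag:
  assumes "finite I" "psd_on I S" "a \<in> I"
  shows "S a a = of_real (Re (S a a))" "0 \<le> Re (S a a)"
proof -
  have "S a a = cnj (S a a)" 
    using assms by (intro hermitian_onD) (auto simp: psd_on_def)
  then show "S a a = of_real (Re (S a a))" by (simp add: complex_eq_iff)
  have "0 \<le> qform I S (\<lambda>p. 0 + (if p = a then 1 else 0))" using assms by (auto simp: psd_on_def)
  also have "\<dots> = Re (S a a)"
    by (subst qform_update) (use assms in \<open>auto simp: psd_on_def qform_def\<close>)
  finally show "0 \<le> Re (S a a)" .
qed

text \<open>Starting from the unit vector of \<open>q\<close>, a move along coordinate
  \<open>a\<close> has no quadratic term, so a nonzero linear term would drive the form below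
  zero.\<close>

lemma psd_on_zero_diag:
  assumes "finite I" "psd_on I S" "a \<in> I" "q \<in> I" "S a a = 0"
  shows "S a q = 0"
proof (rule ccontr)
  assume nz: "S a q \<noteq> 0"
  have herm: "hermitian_on I S" using assms by (auto simp: psd_on_def)
  define r where "r = Re (S q q)"
  define x where "x = (\<lambda>p. 0 + (if p = q then 1 else 0) :: complex)"
  have qx: "qform I S x = r" unfolding x_def
    by (subst qform_update) (use assms herm in \<open>auto simp: qform_def r_def\<close>)
  have sx: "(\<Sum>q\<in>I. S a q * x q) = S a q"
    using assms by (simp add: x_def if_distrib cong: if_cong)
  \<comment> \<open>This factor makes the value of the form \<open>r - (r + 1) = -1\<close>.\<close>
  define s where "s = (r + 1) / (2 * (cmod (S a q))\<^sup>2)"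
  define c where "c = - of_real s * S a q"
  have "0 \<le> qform I S (\<lambda>p. x p + (if p = a then c else 0))" using assms by (auto simp: psd_on_def)
  also have "\<dots> = r + 2 * Re (cnj c * S a q)"
    by (subst qform_update) (use assms herm in \<open>auto simp: qx sx\<close>)
  also have "cnj c * S a q = - of_real (s * (cmod (S a q))\<^sup>2)"
    unfolding c_def using cnj_mult_self[of "S a q"] by (simp del: of_real_power add: mult.assoc)
  also have "s * (cmod (S a q))\<^sup>2 = (r + 1) / 2" using nz by (simp add: s_def)
  finally show False by simp
qed

text \<open>
  Completing the square in the coordinate \<open>a\<close>. If \<open>S a a = 0\<close>, then row and column \<open>a\<close>
  vanish by positivity, and the division by zero is harmless.
\<close>

lemma psd_on_eliminate:
  assumes "finite I" "psd_on I S" "a \<in> I"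
  defines "d \<equiv> Re (S a a)"
  defines "R \<equiv> (\<lambda>p q. S p q - S p a * cnj (S q a) / d)"
  shows "psd_on I R" and "\<And>p. p \<in> I \<Longrightarrow> R p a = 0" and "\<And>p. p \<in> I \<Longrightarrow> R a p = 0"
proof -
  have herm: "hermitian_on I S" using assms by (auto simp: psd_on_def)
  then have h: "\<And>p. p \<in> I \<Longrightarrow> S p a = cnj (S a p)" using assms by (intro hermitian_onD)
  have Saa: "S a a = of_real d" "0 \<le> d" using psd_on_diag[OF assms(1-3)] by (auto simp: d_def)
  have z: "S a q = 0" if "d = 0" "q \<in> I" for q
    using psd_on_zero_diag[OF assms(1-3) that(2)] Saa that by simp
  have hR: "hermitian_on I R" 
  proof (rule hermitian_onI)
    fix p q assume "p \<in> I" "q \<in> I"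
    then have "S q p = cnj (S p q)" by (rule hermitian_onD[OF herm])
    then show "R q p = cnj (R p q)" by (simp add: R_def mult.commute)
  qed
  show "R a p = 0" if "p \<in> I" for p
  proof (cases "d = 0")
    case False then show ?thesis using h[OF that] Saa by (simp add: R_def)
  qed (use z that in \<open>auto simp: R_def Saa\<close>)
  then show "R p a = 0" if "p \<in> I" for p
    using hermitian_onD[OF hR assms(3) that] that by simp
  have "0 \<le> qform I R x" for x
  proof -
    define w where "w = (\<Sum>q\<in>I. S a q * x q)"
    have "(\<Sum>p\<in>I. \<Sum>q\<in>I. cnj (x p) * R p q * x q) =
      (\<Sum>p\<in>I. \<Sum>q\<in>I. cnj (x p) * S p q * x q - (cnj (S a p * x p) * (S a q * x q)) / d)"
      by (intro sum.cong refl) (auto simp: R_def h algebra_simps)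
    also have "\<dots> = (\<Sum>p\<in>I. \<Sum>q\<in>I. cnj (x p) * S p q * x q) - cnj w * w / d"
      by (simp add: sum_subtractf w_def cnj_sum sum_product sum_divide_distrib)
    also have "cnj w * w / d = of_real ((cmod w)\<^sup>2 / d)"
      by (simp add: cnj_mult_self del: of_real_power)
    finally have eq: "qform I R x = qform I S x - (cmod w)\<^sup>2 / d"
      by (simp add: qform_def)
    show ?thesis
    proof (cases "d = 0")
      case True then show ?thesis using eq assms by (auto simp: psd_on_def)
    next
      case False
      \<comment> \<open>The minimizer of the form over coordinate \<open>a\<close>; the minimum is
        the form of \<open>R\<close> at \<open>x\<close>.\<close>
      define c where "c = - w / d"
      have "0 \<le> qform I S (\<lambda>p. x p + (if p = a then c else 0))" using assms by (auto simp: psd_on_def)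
      also have "\<dots> = qform I S x + 2 * Re (cnj c * w) + (cmod c)\<^sup>2 * d"
        by (subst qform_update) (use assms herm in \<open>auto simp: w_def\<close>)
      also have "cnj c * w = - of_real ((cmod w)\<^sup>2 / d)"
        using cnj_mult_self[of w] by (simp add: c_def del: of_real_power)
      also have "(cmod c)\<^sup>2 * d = (cmod w)\<^sup>2 / d"
        using False by (simp add: c_def norm_divide power_divide power2_eq_square)
      finally show ?thesis using eq by simp
    qed
  qed
  then show "psd_on I R" using hR by (auto simp: psd_on_def)
qed

text \<open>Partial Cholesky factorization: the coordinates in \<open>J\<close> are eliminated one
  by one, each contributing one column, and the remainder lives on \<open>I - J\<close>.\<close>

lemma psd_on_cholesky:
  assumes "finite I" "psd_on I S" "J \<subseteq> I"
  shows "\<exists>s R. psd_on I R \<and> (\<forall>p\<in>I. \<forall>q\<in>I. S p q = (\<Sum>i\<in>J. s i p * cnj (s i q)) + R p q) \<and>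
     (\<forall>p\<in>I. \<forall>q\<in>I. p \<in> J \<or> q \<in> J \<longrightarrow> R p q = 0)"
proof -
  have "finite J" using assms finite_subset by blast
  then show ?thesis using assms(3)
  proof (induction J rule: finite_induct)
    case empty
    show ?case by (intro exI[of _ S]) (use assms in auto)
  next
    case (insert a J)
    have "J \<subseteq> I" using insert.prems by simp
    from insert.IH[OF this] obtain s R where sR: "psd_on I R"
      "\<forall>p\<in>I. \<forall>q\<in>I. S p q = (\<Sum>i\<in>J. s i p * cnj (s i q)) + R p q"
      "\<forall>p\<in>I. \<forall>q\<in>I. p \<in> J \<or> q \<in> J \<longrightarrow> R p q = 0" by (elim exE conjE)
    have a: "a \<in> I" using insert.prems by simp
    define d where "d = Re (R a a)"
    have d: "0 \<le> d" using psd_on_diag[OF assms(1) sR(1) a] by (simp add: d_def)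
    define R' where "R' = (\<lambda>p q. R p q - R p a * cnj (R q a) / d)"
    note el = psd_on_eliminate[OF assms(1) sR(1) a, folded d_def, folded R'_def]
    \<comment> \<open>The column of the pivot \<open>a\<close>. If \<open>d = 0\<close>, division
      yields zero both here and in \<open>R'\<close>, so nothing is split off.\<close>
    define s' where "s' = s(a := \<lambda>p. R p a / sqrt d)"
    have sum': "(\<Sum>i\<in>J. s' i p * cnj (s' i q)) = (\<Sum>i\<in>J. s i p * cnj (s i q))" for p q
      by (rule sum.cong) (use insert.hyps in \<open>auto simp: s'_def\<close>)
    have "complex_of_real (sqrt d) * complex_of_real (sqrt d) = d"
      using d by (metis of_real_mult real_sqrt_mult_self abs_of_nonneg)
    then have "s' a p * cnj (s' a q) = R p a * cnj (R q a) / d" for p q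
      by (simp add: s'_def)
    then have "S p q = (\<Sum>i\<in>insert a J. s' i p * cnj (s' i q)) + R' p q" if "p \<in> I" "q \<in> I" for p q
      using insert.hyps bspec[OF bspec[OF sR(2) that(1)] that(2)] by (simp add: sum' R'_def)
    moreover have "R' p q = 0" if pq: "p \<in> I" "q \<in> I" "p \<in> insert a J \<or> q \<in> insert a J" for p q
    proof -
      consider "p = a" | "q = a" | "p \<in> J" | "q \<in> J" using pq by blast
      then show ?thesis
        by cases (use pq sR(3) a el(2)[of p] el(3)[of q] in \<open>simp_all add: R'_def\<close>)
    qed
    ultimately show ?case using el(1) by blast
  qed
qed

text \<open>Schur complement of an identity block: all pivots are 1, and eliminating one leaves the
  other columns of the block unchanged.\<close>

lemma psd_on_eliminate_unit_block:
  assumes "finite I" "psd_on I S" "A \<subseteq> I" "\<And>p q. p \<in> A \<Longrightarrow> q \<in> A \<Longrightarrow> S p q = of_bool (p = q)"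
  shows "psd_on I (\<lambda>p q. S p q - (\<Sum>i\<in>A. S p i * cnj (S q i)))"
proof -
  have "finite A" using assms finite_subset by blast
  then show ?thesis using assms(2-)
  proof (induction A arbitrary: S rule: finite_induct)
    case (insert a A)
    define R where "R = (\<lambda>p q. S p q - S p a * cnj (S q a))"
    have "Re (S a a) = 1" using insert.prems(3)[of a a] by simp
    then have psdR: "psd_on I R"
      using psd_on_eliminate(1)[OF assms(1) insert.prems(1), of a] insert.prems by (simp add: R_def)
    have R: "R p i = S p i" if "i \<in> A" for p i
    proof -
      have "S i a = 0" using insert.prems(3)[of i a] insert.hyps that by auto
      then show ?thesis by (simp add: R_def)
    qed
    have "psd_on I (\<lambda>p q. R p q - (\<Sum>i\<in>A. R p i * cnj (R q i)))"
    proof (rule insert.IH[OF psdR])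
      show "R p q = of_bool (p = q)" if "p \<in> A" "q \<in> A" for p q
        using R[OF that(2)] insert.prems(3) that by simp
    qed (use insert.prems in auto)
    moreover have "(\<Sum>i\<in>A. R p i * cnj (R q i)) = (\<Sum>i\<in>A. S p i * cnj (S q i))" for p q
      using R by (intro sum.cong) simp_all
    ultimately show ?case using insert.hyps by (simp add: R_def diff_diff_eq)
  qed simp
qed

lemma qform_sum_squares:
  "qform I (\<lambda>p q. (\<Sum>i\<in>J. s i p * cnj (s i q)) + R p q) x =
     (\<Sum>i\<in>J. (cmod (\<Sum>p\<in>I. cnj (x p) * s i p))\<^sup>2) + qform I R x"
proof -
  have "(\<Sum>p\<in>I. \<Sum>q\<in>I. cnj (x p) * ((\<Sum>i\<in>J. s i p * cnj (s i q)) + R p q) * x q) =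
     (\<Sum>p\<in>I. \<Sum>q\<in>I. \<Sum>i\<in>J. (cnj (x p) * s i p) * cnj (cnj (x q) * s i q)) + 
     (\<Sum>p\<in>I. \<Sum>q\<in>I. cnj (x p) * R p q * x q)"
    by (simp add: sum.distrib[symmetric] algebra_simps sum_distrib_left)
  also have "(\<Sum>p\<in>I. \<Sum>q\<in>I. \<Sum>i\<in>J. (cnj (x p) * s i p) * cnj (cnj (x q) * s i q)) = 
     (\<Sum>i\<in>J. \<Sum>p\<in>I. \<Sum>q\<in>I. (cnj (x p) * s i p) * cnj (cnj (x q) * s i q))"
  proof -
    have "(\<Sum>p\<in>I. \<Sum>q\<in>I. \<Sum>i\<in>J. (cnj (x p) * s i p) * cnj (cnj (x q) * s i q)) =
       (\<Sum>p\<in>I. \<Sum>i\<in>J. \<Sum>q\<in>I. (cnj (x p) * s i p) * cnj (cnj (x q) * s i q))"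
      by (intro sum.cong refl sum.swap)
    also have "\<dots> = (\<Sum>i\<in>J. \<Sum>p\<in>I. \<Sum>q\<in>I. (cnj (x p) * s i p) * cnj (cnj (x q) * s i q))"
      by (rule sum.swap)
    finally show ?thesis .
  qed
  also have "\<dots> = (\<Sum>i\<in>J. (\<Sum>p\<in>I. cnj (x p) * s i p) * cnj (\<Sum>p\<in>I. cnj (x p) * s i p))"
    by (simp only: cnj_sum sum_product)
  also have "\<dots> = of_real (\<Sum>i\<in>J. (cmod (\<Sum>p\<in>I. cnj (x p) * s i p))\<^sup>2)"
    by (simp only: complex_norm_square[symmetric] of_real_sum)
  finally show ?thesis by (simp add: qform_def)
qed

lemma qform_cong:
  "(\<And>p q. p \<in> I \<Longrightarrow> q \<in> I \<Longrightarrow> S p q = R p q) \<Longrightarrow> qform I S x = qform I R x"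
  by (simp add: qform_def cong: sum.cong)

lemma psd_on_singular_factor:
  assumes fin: "finite I" and AI: "A \<subseteq> I" and S: "psd_on I S"
    and SA: "\<forall>p\<in>A. \<forall>q\<in>A. S p q = of_bool (p = q)"
    and u: "\<exists>p\<in>I. u p \<noteq> 0" "qform I S u = 0"
  shows "\<exists>j\<in>I - A. \<exists>s. (\<forall>p\<in>I. \<forall>q\<in>I. S p q = (\<Sum>i\<in>I - {j}. s i p * cnj (s i q))) \<and>
     (\<forall>i\<in>A. \<forall>p\<in>A. s i p = of_bool (p = i)) \<and> (\<forall>i\<in>I - A - {j}. \<forall>p\<in>A. s i p = 0)"
proof -
  have finA: "finite A" using fin AI finite_subset by blast
  \<comment> \<open>On vectors supported in \<open>A\<close> the form is the squared norm.\<close>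
  have "\<exists>j\<in>I - A. u j \<noteq> 0"
  proof (rule ccontr)
    assume "\<not> ?thesis"
    then have z: "\<And>p. p \<in> I - A \<Longrightarrow> u p = 0" by auto
    have "(\<Sum>p\<in>I. \<Sum>q\<in>I. cnj (u p) * S p q * u q) = (\<Sum>p\<in>A. \<Sum>q\<in>A. cnj (u p) * S p q * u q)"
    proof -
      have "(\<Sum>p\<in>I. \<Sum>q\<in>I. cnj (u p) * S p q * u q) = (\<Sum>p\<in>I. \<Sum>q\<in>A. cnj (u p) * S p q * u q)"
        by (intro sum.cong refl sum.mono_neutral_right) (use fin AI z in auto)
      also have "\<dots> = (\<Sum>p\<in>A. \<Sum>q\<in>A. cnj (u p) * S p q * u q)"
        by (intro sum.mono_neutral_right) (use fin AI z in auto)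
      finally show ?thesis .
    qed
    also have "\<dots> = (\<Sum>p\<in>A. \<Sum>q\<in>A. if q = p then cnj (u p) * u p else 0)"
      by (intro sum.cong refl) (auto simp: SA)
    also have "\<dots> = (\<Sum>p\<in>A. u p * cnj (u p))" using finA by (simp add: mult.commute)
    also have "\<dots> = of_real (\<Sum>p\<in>A. (cmod (u p))\<^sup>2)"
      by (simp only: complex_norm_square[symmetric] of_real_sum)
    finally have "(\<Sum>p\<in>A. (cmod (u p))\<^sup>2) = 0" using u(2) by (simp add: qform_def)
    then have "\<forall>p\<in>A. u p = 0" using finA by (subst (asm) sum_nonneg_eq_0_iff) auto
    with z u(1) show False by blast
  qed
  then obtain j where j: "j \<in> I" "j \<notin> A" "u j \<noteq> 0" by auto
  define S' where "S' = (\<lambda>p q. S p q - (\<Sum>i\<in>A. S p i * cnj (S q i)))"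
  have S': "psd_on I S'" unfolding S'_def by (rule psd_on_eliminate_unit_block[OF fin S AI]) (use SA in blast)
  define J where "J = I - A - {j}"
  obtain s R where R: "psd_on I R"
      "\<And>p q. p \<in> I \<Longrightarrow> q \<in> I \<Longrightarrow> S' p q = (\<Sum>i\<in>J. s i p * cnj (s i q)) + R p q"
      "\<And>p q. p \<in> I \<Longrightarrow> q \<in> I \<Longrightarrow> p \<in> J \<or> q \<in> J \<Longrightarrow> R p q = 0"
    using psd_on_cholesky[OF fin S', of J] unfolding J_def by blast
  have S'A: "S' p p = 0" if "p \<in> A" for p
  proof -
    have "(\<Sum>i\<in>A. S p i * cnj (S p i)) = (\<Sum>i\<in>A. if i = p then 1 else 0)"
      by (intro sum.cong refl) (use SA that in auto)
    then show ?thesis using that finA by (simp add: S'_def SA)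
  qed
  \<comment> \<open>The diagonal of \<open>S'\<close> vanishes on \<open>A\<close> and is a sum of
    these nonnegative terms.\<close>
  have sRA: "(\<forall>i\<in>J. s i p = 0) \<and> R p p = 0" if "p \<in> A" for p
  proof -
    have pI: "p \<in> I" using that AI by auto
    have "0 = (\<Sum>i\<in>J. s i p * cnj (s i p)) + R p p" using R(2)[OF pI pI] S'A[OF that] by simp
    also have "\<dots> = of_real ((\<Sum>i\<in>J. (cmod (s i p))\<^sup>2) + Re (R p p))"
      using psd_on_diag(1)[OF fin R(1) pI] by (simp add: complex_norm_square[symmetric] del: of_real_power)
    finally have "(\<Sum>i\<in>J. (cmod (s i p))\<^sup>2) + Re (R p p) = 0"
      by (metis of_real_eq_0_iff)
    moreover have "0 \<le> (\<Sum>i\<in>J. (cmod (s i p))\<^sup>2)" by (simp add: sum_nonneg)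
    ultimately have *: "(\<Sum>i\<in>J. (cmod (s i p))\<^sup>2) = 0" "Re (R p p) = 0"
      using psd_on_diag(2)[OF fin R(1) pI] by linarith+
    have "finite J" using fin by (simp add: J_def)
    then have "\<forall>i\<in>J. s i p = 0" using *(1) by (subst (asm) sum_nonneg_eq_0_iff) auto
    with *(2) psd_on_diag(1)[OF fin R(1) pI] show ?thesis by simp
  qed
  have Rz: "R p q = 0" if "p \<in> I" "q \<in> I" "p \<noteq> j \<or> q \<noteq> j" for p q
  proof -
    have l: "R p q = 0" if "p \<in> I" "q \<in> I" "p \<noteq> j" for p q
    proof (cases "p \<in> A")
      case True then show ?thesis using psd_on_zero_diag[OF fin R(1)] that sRA by blast
    next
      case False then show ?thesis using R(3)[OF that(1,2)] that by (auto simp: J_def)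
    qed
    then show ?thesis using that R(1)
      by (metis psd_on_def hermitian_onD complex_cnj_zero)
  qed
  define t where "t = (\<lambda>i. if i \<in> A then (\<lambda>p. S p i) else s i)"
  have IJ: "I - {j} = A \<union> J" "A \<inter> J = {}" "finite J" using AI j fin by (auto simp: J_def)
  have t: "(\<Sum>i\<in>I - {j}. t i p * cnj (t i q)) = (\<Sum>i\<in>A. S p i * cnj (S q i)) + (\<Sum>i\<in>J. s i p * cnj (s i q))" for p q
  proof -
    have "(\<Sum>i\<in>I - {j}. t i p * cnj (t i q)) = (\<Sum>i\<in>A. t i p * cnj (t i q)) + (\<Sum>i\<in>J. t i p * cnj (t i q))"
      unfolding IJ(1) using IJ finA by (simp add: sum.union_disjoint)
    also have "\<dots> = (\<Sum>i\<in>A. S p i * cnj (S q i)) + (\<Sum>i\<in>J. s i p * cnj (s i q))"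
      using IJ(2) by (intro arg_cong2[where f="(+)"] sum.cong refl) (auto simp: t_def)
    finally show ?thesis .
  qed
  have dec: "S p q = (\<Sum>i\<in>I - {j}. t i p * cnj (t i q)) + R p q" if "p \<in> I" "q \<in> I" for p q
    using R(2)[OF that] by (simp add: t S'_def algebra_simps)
  \<comment> \<open>The form vanishes at \<open>u\<close> and is a sum of squares plus
    \<open>R j j\<close> times \<open>(cmod (u j))\<^sup>2\<close>.\<close>
  have "R j j = 0"
  proof -
    have "0 = qform I (\<lambda>p q. (\<Sum>i\<in>I - {j}. t i p * cnj (t i q)) + R p q) u"
      using u(2) qform_cong[of I S, OF dec] by simp
    also have "\<dots> \<ge> qform I R u" unfolding qform_sum_squares by (simp add: sum_nonneg)
    finally have "qform I R u \<le> 0" .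
    moreover have "(\<Sum>p\<in>I. \<Sum>q\<in>I. cnj (u p) * R p q * u q) = R j j * (u j * cnj (u j))"
    proof -
      have "(\<Sum>p\<in>I. \<Sum>q\<in>I. cnj (u p) * R p q * u q) =
         (\<Sum>p\<in>I. \<Sum>q\<in>I. if q = j then (if p = j then R j j * (u j * cnj (u j)) else 0) else 0)"
        by (intro sum.cong refl) (auto simp: Rz)
      then show ?thesis using fin j by simp
    qed
    moreover have "\<dots> = of_real (Re (R j j) * (cmod (u j))\<^sup>2)"
      using psd_on_diag(1)[OF fin R(1) j(1)] by (simp add: complex_norm_square[symmetric] del: of_real_power)
    ultimately have "Re (R j j) * (cmod (u j))\<^sup>2 \<le> 0" by (simp add: qform_def)
    then have "Re (R j j) = 0" using psd_on_diag(2)[OF fin R(1) j(1)] j(3)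
      by (simp add: mult_le_0_iff)
    then show ?thesis using psd_on_diag(1)[OF fin R(1) j(1)] by simp
  qed
  then have "\<forall>p\<in>I. \<forall>q\<in>I. S p q = (\<Sum>i\<in>I - {j}. t i p * cnj (t i q))" using dec Rz by force
  moreover have "\<forall>i\<in>A. \<forall>p\<in>A. t i p = of_bool (p = i)" by (auto simp: t_def SA)
  moreover have "\<forall>i\<in>J. \<forall>p\<in>A. t i p = 0" using sRA IJ by (auto simp: t_def J_def)
  ultimately show ?thesis using j unfolding J_def by blast
qed

section \<open>Compactness and the first singular point of 1 + t D\<close>

text \<open>Tychonoff's theorem. Vectors and column sequences are total functions, so extrema are
  found in the product topology.\<close>

lemma compact_function_box:
  fixes S :: "'a \<Rightarrow> 'b::topological_space set"
  assumes "\<And>i. compact (S i)"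
  shows "compact {f. \<forall>i. f i \<in> S i}"
proof -
  have "compactin (product_topology (\<lambda>_. euclidean) UNIV) (PiE UNIV S)"
    using assms by (simp add: compactin_PiE)
  moreover have "PiE UNIV S = {f. \<forall>i. f i \<in> S i}" by (auto simp: PiE_UNIV_domain)
  ultimately show ?thesis by (simp add: euclidean_product_topology)
qed

lemma qform_identity:
  assumes "finite I"
  shows "qform I (\<lambda>p q. of_bool (p = q)) x = (\<Sum>p\<in>I. (cmod (x p))\<^sup>2)"
proof -
  have "(\<Sum>p\<in>I. \<Sum>q\<in>I. cnj (x p) * of_bool (p = q) * x q) = (\<Sum>p\<in>I. \<Sum>q\<in>I. if q = p then cnj (x p) * x p else 0)"
    by (intro sum.cong refl) auto
  also have "\<dots> = of_real (\<Sum>p\<in>I. (cmod (x p))\<^sup>2)"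
    using assms by (simp add: cnj_mult_self)
  finally show ?thesis by (simp add: qform_def)
qed

lemma qform_add_scaled:
  "qform I (\<lambda>p q. S p q + complex_of_real t * R p q) x = qform I S x + t * qform I R x"
proof -
  have "(\<Sum>p\<in>I. \<Sum>q\<in>I. cnj (x p) * (S p q + complex_of_real t * R p q) * x q) =
    (\<Sum>p\<in>I. \<Sum>q\<in>I. cnj (x p) * S p q * x q + complex_of_real t * (cnj (x p) * R p q * x q))"
    by (intro sum.cong refl) (simp add: algebra_simps)
  also have "\<dots> = (\<Sum>p\<in>I. \<Sum>q\<in>I. cnj (x p) * S p q * x q) +
    complex_of_real t * (\<Sum>p\<in>I. \<Sum>q\<in>I. cnj (x p) * R p q * x q)"
    by (simp add: sum.distrib sum_distrib_left)
  finally show ?thesis by (simp add: qform_def del: Re_sum)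
qed

lemma qform_scale: "qform I S (\<lambda>p. complex_of_real c * x p) = c\<^sup>2 * qform I S x"
proof -
  have "(\<Sum>p\<in>I. \<Sum>q\<in>I. cnj (complex_of_real c * x p) * S p q * (complex_of_real c * x q)) =
    complex_of_real (c\<^sup>2) * (\<Sum>p\<in>I. \<Sum>q\<in>I. cnj (x p) * S p q * x q)"
    unfolding sum_distrib_left by (intro sum.cong refl) (simp add: power2_eq_square)
  then show ?thesis unfolding qform_def by (simp del: Re_sum of_real_power)
qed

text \<open>With \<open>m < 0\<close> the minimum of the form on the unit sphere, \<open>t = - 1 / m\<close> works.\<close>

lemma psd_on_singular_shift:
  fixes D :: "'i \<Rightarrow> 'i \<Rightarrow> complex"
  assumes "finite I" "hermitian_on I D" "qform I D y < 0"
  shows "\<exists>t>0. psd_on I (\<lambda>p q. of_bool (p = q) + complex_of_real t * D p q) \<and>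
    (\<exists>u. (\<exists>p\<in>I. u p \<noteq> 0) \<and> qform I (\<lambda>p q. of_bool (p = q) + complex_of_real t * D p q) u = 0)"
proof -
  define n where "n = (\<lambda>x :: 'i \<Rightarrow> complex. \<Sum>p\<in>I. (cmod (x p))\<^sup>2)"
  \<comment> \<open>Coordinates outside \<open>I\<close> do not affect the form; bounding them as
    well makes the sphere compact.\<close>
  define sphere where "sphere = {x. \<forall>p. x p \<in> cball 0 1} \<inter> {x. n x = 1}"
  have cont: "continuous_on UNIV (qform I D)" "continuous_on UNIV n"
    unfolding qform_def n_def by (intro continuous_intros; simp)+
  have "compact sphere" unfolding sphere_def
    by (intro compact_Int_closed compact_function_box closed_Collect_eq cont continuous_intros) auto
  have ncong: "n x = n x'" "qform I D x = qform I D x'" if "\<And>p. p \<in> I \<Longrightarrow> x p = x' p" for x x'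
    using that by (simp_all add: n_def qform_def cong: sum.cong)
  \<comment> \<open>Homogeneity of the form reduces every nonzero vector to the sphere.\<close>
  have normalize: "\<exists>x'\<in>sphere. qform I D x = n x * qform I D x'" if "n x \<noteq> 0" for x
  proof -
    have npos: "n x > 0" using that by (simp add: n_def sum_nonneg order_less_le)
    define x' where "x' = (\<lambda>p. complex_of_real (1 / sqrt (n x)) * (if p \<in> I then x p else 0))"
    have *: "qform I D x' = qform I D x / n x"
      unfolding x'_def qform_scale using npos ncong(2)[of "\<lambda>p. if p \<in> I then x p else 0" x]
      by (simp add: power_divide)
    have "n x' = (\<Sum>p\<in>I. (cmod (x' p))\<^sup>2)" by (simp add: n_def)
    also have "\<dots> = (\<Sum>p\<in>I. (cmod (x p))\<^sup>2 / n x)"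
      by (intro sum.cong refl) (use npos in \<open>simp add: x'_def norm_mult norm_divide power_mult_distrib power_divide\<close>)
    also have "\<dots> = n x / n x" by (simp only: sum_divide_distrib[symmetric]) (simp only: n_def)
    also have "\<dots> = 1" using npos by simp
    finally have n1: "n x' = 1" .
    have "cmod (x' p) \<le> 1" for p
    proof (cases "p \<in> I")
      case True
      have "(cmod (x' p))\<^sup>2 \<le> n x'" unfolding n_def using True assms by (intro member_le_sum) auto
      then show ?thesis using n1 by (simp add: abs_square_le_1)
    qed (simp add: x'_def)
    then show ?thesis using n1 * npos by (intro bexI[of _ x']) (auto simp: sphere_def)
  qed
  have n0: "x p = 0" if "n x = 0" "p \<in> I" for x p
    using that assms(1) by (simp add: n_def sum_nonneg_eq_0_iff)
  have ny: "n y \<noteq> 0"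
  proof
    assume "n y = 0"
    then have "qform I D y = 0" unfolding qform_def using n0[of y] by simp
    then show False using assms by simp
  qed
  then have "sphere \<noteq> {}" using normalize by blast
  then obtain u where u: "u \<in> sphere" "\<And>x. x \<in> sphere \<Longrightarrow> qform I D u \<le> qform I D x"
    using continuous_attains_inf[OF \<open>compact sphere\<close> _ continuous_on_subset[OF cont(1)]] by blast
  define m where "m = qform I D u"
  have lower: "m * n x \<le> qform I D x" for x
  proof (cases "n x = 0")
    case True
    then have "qform I D x = 0" unfolding qform_def using n0[of x] by simp
    then show ?thesis using True by simp
  next
    case False
    then obtain x' where "x' \<in> sphere" "qform I D x = n x * qform I D x'" using normalize by blast
    moreover have "0 \<le> n x" by (simp add: n_def sum_nonneg)
    ultimately show ?thesis using u(2)[of x'] by (simp add: m_def mult.commute mult_left_mono)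
  qed
  have "m < 0"
  proof (rule ccontr)
    assume "\<not> m < 0"
    then have "0 \<le> m * n y" by (simp add: n_def sum_nonneg)
    then show False using lower[of y] assms by simp
  qed
  define t where "t = - 1 / m"
  have t: "0 < t" "t * m = - 1" using \<open>m < 0\<close> by (auto simp: t_def divide_neg_neg)
  define S where "S = (\<lambda>p q. of_bool (p = q) + complex_of_real t * D p q)"
  have qS: "qform I S x = n x + t * qform I D x" for x
    unfolding S_def qform_add_scaled using assms(1) by (simp add: qform_identity n_def)
  have "0 \<le> qform I S x" for x
  proof -
    have "t * (m * n x) \<le> t * qform I D x" using lower t(1) by (simp add: mult_left_mono)
    then show ?thesis unfolding qS using t(2) by (simp add: mult.assoc[symmetric])
  qed
  moreover have "hermitian_on I S"
  proof (rule hermitian_onI)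
    fix p q assume "p \<in> I" "q \<in> I"
    then have "D q p = cnj (D p q)" by (rule hermitian_onD[OF assms(2)])
    then show "S q p = cnj (S p q)" by (auto simp: S_def)
  qed
  ultimately have "psd_on I S" by (simp add: psd_on_def)
  moreover have nu: "n u = 1" using u(1) by (simp add: sphere_def)
  then have "qform I S u = 0" using t(2) by (simp add: qS m_def)
  moreover have "\<exists>p\<in>I. u p \<noteq> 0"
  proof (rule ccontr)
    assume "\<not> ?thesis"
    then have "n u = 0" by (simp add: n_def)
    then show False using nu by simp
  qed
  ultimately show ?thesis using t(1) unfolding S_def by blast
qed

text \<open>A vanishing form is in particular nonnegative, so \<open>psd_on_zero_diag\<close>
  applies once the diagonal is known to vanish.\<close>

lemma hermitian_on_qform_zero:
  assumes "finite I" "hermitian_on I D" "\<And>x. qform I D x = 0" "p \<in> I" "q \<in> I"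
  shows "D p q = 0"
proof -
  have psd: "psd_on I D" using assms by (simp add: psd_on_def)
  have "0 = qform I D (\<lambda>q. 0 + (if q = p then 1 else 0))" using assms by simp
  also have "\<dots> = Re (D p p)"
    by (subst qform_update) (use assms in \<open>auto simp: qform_def\<close>)
  finally have "D p p = 0" using psd_on_diag(1)[OF assms(1) psd assms(4)] by simp
  then show ?thesis using psd_on_zero_diag[OF assms(1) psd] assms by blast
qed

section \<open>Removing a column\<close>

text \<open>The product V S V^H over the columns in \<open>I\<close>.\<close>

definition weighted_gram ::
  "nat set \<Rightarrow> (nat \<Rightarrow> nat \<Rightarrow> complex) \<Rightarrow> (nat \<Rightarrow> complex^'nt) \<Rightarrow> complex^'nt^'nt" where
  "weighted_gram I S V = (\<chi> a b. \<Sum>p\<in>I. \<Sum>q\<in>I. S p q * (V p $ a * cnj (V q $ b)))"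

lemma weighted_gram_identity:
  assumes "finite I"
  shows "weighted_gram I (\<lambda>p q. of_bool (p = q)) V = col_gram I V"
proof -
  have "(\<Sum>p\<in>I. \<Sum>q\<in>I. of_bool (p = q) * (V p $ a * cnj (V q $ b))) =
     (\<Sum>p\<in>I. \<Sum>q\<in>I. if q = p then V p $ a * cnj (V p $ b) else 0)" for a b
    by (intro sum.cong refl) auto
  then show ?thesis using assms by (simp add: weighted_gram_def col_gram_def)
qed

text \<open>S = T T^H gives V S V^H = (V T)(V T)^H, where the \<open>s i\<close> are the columns of
  T.\<close>

lemma weighted_gram_factor:
  assumes "\<And>p q. p \<in> I \<Longrightarrow> q \<in> I \<Longrightarrow> S p q = (\<Sum>i\<in>J. s i p * cnj (s i q))"
  shows "weighted_gram I S V = col_gram J (\<lambda>i. \<chi> a. \<Sum>p\<in>I. s i p * V p $ a)"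
proof -
  have "(\<Sum>p\<in>I. \<Sum>q\<in>I. S p q * (V p $ a * cnj (V q $ b))) =
     (\<Sum>i\<in>J. (\<Sum>p\<in>I. s i p * V p $ a) * cnj (\<Sum>q\<in>I. s i q * V q $ b))" for a b
  proof -
    have "(\<Sum>p\<in>I. \<Sum>q\<in>I. S p q * (V p $ a * cnj (V q $ b))) =
      (\<Sum>p\<in>I. \<Sum>q\<in>I. \<Sum>i\<in>J. (s i p * V p $ a) * cnj (s i q * V q $ b))"
      by (intro sum.cong refl) (simp add: assms sum_distrib_left sum_distrib_right mult_ac)
    also have "\<dots> = (\<Sum>p\<in>I. \<Sum>i\<in>J. \<Sum>q\<in>I. (s i p * V p $ a) * cnj (s i q * V q $ b))"
      by (intro sum.cong refl sum.swap)
    also have "\<dots> = (\<Sum>i\<in>J. \<Sum>p\<in>I. \<Sum>q\<in>I. (s i p * V p $ a) * cnj (s i q * V q $ b))"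
      by (rule sum.swap)
    finally show ?thesis by (simp only: sum_product cnj_sum)
  qed
  then show ?thesis by (simp add: weighted_gram_def col_gram_def)
qed

text \<open>Brings the trace into the shape of the equations in
  \<open>hermitian_kernel\<close>.\<close>

lemma trace_weighted_gram:
  "trace (C ** weighted_gram I S V) =
     (\<Sum>p\<in>I. \<Sum>q\<in>I. S p q * (\<Sum>a\<in>UNIV. \<Sum>b\<in>UNIV. C $ a $ b * (V p $ b * cnj (V q $ a))))"
proof -
  have "trace (C ** weighted_gram I S V) =
    (\<Sum>a\<in>UNIV. \<Sum>b\<in>UNIV. \<Sum>p\<in>I. \<Sum>q\<in>I. S p q * (C $ a $ b * (V p $ b * cnj (V q $ a))))"
    by (simp add: trace_def matrix_matrix_mult_def weighted_gram_def sum_distrib_left mult.left_commute)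
  also have "\<dots> = (\<Sum>a\<in>UNIV. \<Sum>p\<in>I. \<Sum>b\<in>UNIV. \<Sum>q\<in>I. S p q * (C $ a $ b * (V p $ b * cnj (V q $ a))))"
    by (intro sum.cong refl sum.swap)
  also have "\<dots> = (\<Sum>a\<in>UNIV. \<Sum>p\<in>I. \<Sum>q\<in>I. \<Sum>b\<in>UNIV. S p q * (C $ a $ b * (V p $ b * cnj (V q $ a))))"
    by (intro sum.cong refl sum.swap)
  also have "\<dots> = (\<Sum>p\<in>I. \<Sum>a\<in>UNIV. \<Sum>q\<in>I. \<Sum>b\<in>UNIV. S p q * (C $ a $ b * (V p $ b * cnj (V q $ a))))"
    by (rule sum.swap)
  also have "\<dots> = (\<Sum>p\<in>I. \<Sum>q\<in>I. \<Sum>a\<in>UNIV. \<Sum>b\<in>UNIV. S p q * (C $ a $ b * (V p $ b * cnj (V q $ a))))"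
    by (intro sum.cong refl sum.swap)
  finally show ?thesis by (simp add: sum_distrib_left)
qed

lemma trace_weighted_gram_add_scaled:
  "Re (trace (C ** weighted_gram I (\<lambda>p q. S p q + complex_of_real t * D p q) V)) =
     Re (trace (C ** weighted_gram I S V)) + t * Re (trace (C ** weighted_gram I D V))"
proof -
  have "trace (C ** weighted_gram I (\<lambda>p q. S p q + complex_of_real t * D p q) V) =
     trace (C ** weighted_gram I S V) + complex_of_real t * trace (C ** weighted_gram I D V)"
    unfolding trace_weighted_gram by (simp only: distrib_right sum.distrib sum_distrib_left mult.assoc)
  then show ?thesis by simp
qed

text \<open>The trace sums the form over the conjugated rows of \<open>V\<close>. By contraposition,
  a negative trace yields a negative value of the form.\<close>

lemma trace_weighted_gram_nonneg:
  assumes "\<And>x. 0 \<le> qform I S x"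
  shows "0 \<le> Re (trace (weighted_gram I S V))"
proof -
  have "Re (trace (weighted_gram I S V)) = (\<Sum>a\<in>UNIV. qform I S (\<lambda>p. cnj (V p $ a)))"
    by (simp add: trace_def weighted_gram_def qform_def mult.assoc mult.left_commute del: Re_sum flip: Re_sum)
  then show ?thesis using assms by (simp add: sum_nonneg)
qed

text \<open>\<open>A\<close> holds the columns whose signals must survive: none with interference
  cancellation, the communication columns without. The last clause holds because the factor of 1 + t
  D is the identity on \<open>A\<close>, and \<open>g\<close> does not see admixtures of the other
  columns.\<close>

lemma remove_column:
  fixes V :: "nat \<Rightarrow> complex^'nt" and C :: "'e \<Rightarrow> complex^'nt^'nt"
  assumes fin: "finite I" "A \<subseteq> I" "finite E" and card: "card E + (card A)\<^sup>2 < (card I)\<^sup>2"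
  shows "\<exists>j\<in>I - A. \<exists>V'.
    (\<forall>e\<in>E. Re (trace (C e ** col_gram (I - {j}) V')) = Re (trace (C e ** col_gram I V))) \<and>
    Re (trace (col_gram (I - {j}) V')) \<le> Re (trace (col_gram I V)) \<and>
    (\<forall>g. (\<forall>s\<in>I - A. herm_prod g (V s) = 0) \<longrightarrow>
       (\<forall>i\<in>A. herm_prod g (V' i) = herm_prod g (V i)) \<and> (\<forall>i\<in>I - A - {j}. herm_prod g (V' i) = 0))"
proof -
  define \<tau> where "\<tau> = (\<lambda>D. Re (trace (weighted_gram I D V)))"
  define ker where "ker = (\<lambda>D. hermitian_on I D \<and> (\<forall>p\<in>A. \<forall>q\<in>A. D p q = 0) \<and>
     (\<forall>e\<in>E. Re (trace (C e ** weighted_gram I D V)) = 0))"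
  have finA: "finite A" using fin finite_subset by blast
  obtain D where D: "ker D" "\<exists>p\<in>I. \<exists>q\<in>I. D p q \<noteq> 0"
    using hermitian_kernel[OF fin card, of "\<lambda>e p q. \<Sum>a\<in>UNIV. \<Sum>b\<in>UNIV. C e $ a $ b * (V p $ b * cnj (V q $ a))"]
    unfolding ker_def trace_weighted_gram by blast
  \<comment> \<open>The negative of \<open>D\<close>, written so that the lemmas on scaled sums
    apply.\<close>
  define D' where "D' = (\<lambda>p q. 0 + complex_of_real (- 1) * D p q)"
  have qD': "qform I D' x = - qform I D x" for x
    unfolding D'_def qform_add_scaled by (simp add: qform_def)
  have trD': "Re (trace (B ** weighted_gram I D' V)) = - Re (trace (B ** weighted_gram I D V))" for B
    unfolding D'_def trace_weighted_gram_add_scaled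
    by (simp add: trace_weighted_gram)
  have tauD': "\<tau> D' = - \<tau> D" using trD'[of "mat 1"] by (simp add: \<tau>_def)
  have hD: "hermitian_on I D" using D(1) by (simp add: ker_def)
  have "hermitian_on I D'"
  proof (rule hermitian_onI)
    fix p q assume "p \<in> I" "q \<in> I"
    then have "D q p = cnj (D p q)" by (rule hermitian_onD[OF hD])
    then show "D' q p = cnj (D' p q)" by (simp add: D'_def)
  qed
  then have kerD': "ker D'" using D(1) trD' by (simp add: ker_def D'_def)
  \<comment> \<open>A nonzero trace selects the sign with negative trace, and then the form is
    negative somewhere. If the trace is zero, both signs are allowed and one of them has a negative
    value.\<close>
  have "\<exists>D y. ker D \<and> \<tau> D \<le> 0 \<and> qform I D y < 0"
  proof -
    have nonneg: "0 \<le> \<tau> D0" if "\<And>x. 0 \<le> qform I D0 x" for D0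
      unfolding \<tau>_def using that by (rule trace_weighted_gram_nonneg)
    obtain x where "qform I D x \<noteq> 0"
      using hermitian_on_qform_zero[OF fin(1) hD] D(2) by blast
    then have x: "qform I D x < 0 \<or> qform I D' x < 0" by (auto simp: qD')
    consider "\<tau> D < 0" | "\<tau> D' < 0" | "\<tau> D = 0" "\<tau> D' = 0" using tauD' by linarith
    then show ?thesis
    proof cases
      case 1
      then obtain y where "qform I D y < 0" using nonneg[of D] by (meson not_le)
      then show ?thesis using 1 D by (intro exI[of _ D]) auto
    next
      case 2
      then obtain y where "qform I D' y < 0" using nonneg[of D'] by (meson not_le)
      then show ?thesis using 2 kerD' by (intro exI[of _ D']) auto
    next
      case 3
      then show ?thesis using x D kerD' by (metis order_refl)
    qed
  qed
  then obtain D y where D: "ker D" "\<tau> D \<le> 0" "qform I D y < 0" by blast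
  obtain t u where t: "t > 0" "psd_on I (\<lambda>p q. of_bool (p = q) + complex_of_real t * D p q)"
    "\<exists>p\<in>I. u p \<noteq> 0" "qform I (\<lambda>p q. of_bool (p = q) + complex_of_real t * D p q) u = 0"
    using psd_on_singular_shift[OF fin(1) _ D(3)] D(1) unfolding ker_def by blast
  define S where "S = (\<lambda>p q. of_bool (p = q) + complex_of_real t * D p q)"
  have SA: "\<forall>p\<in>A. \<forall>q\<in>A. S p q = of_bool (p = q)"
    using D(1) by (simp add: S_def ker_def)
  from psd_on_singular_factor[OF fin(1,2) t(2)[folded S_def] SA t(3) t(4)[folded S_def]]
  obtain j s where j: "j \<in> I - A"
    and s: "\<forall>p\<in>I. \<forall>q\<in>I. S p q = (\<Sum>i\<in>I - {j}. s i p * cnj (s i q))"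
      "\<forall>i\<in>A. \<forall>p\<in>A. s i p = of_bool (p = i)" "\<forall>i\<in>I - A - {j}. \<forall>p\<in>A. s i p = 0"
    by (elim bexE exE conjE)
  define V' where "V' = (\<lambda>i. \<chi> a. \<Sum>p\<in>I. s i p * V p $ a)"
  have gram: "col_gram (I - {j}) V' = weighted_gram I S V"
    unfolding V'_def by (rule weighted_gram_factor[symmetric]) (use s(1) in blast)
  have tr: "Re (trace (B ** col_gram (I - {j}) V')) =
     Re (trace (B ** col_gram I V)) + t * Re (trace (B ** weighted_gram I D V))" for B
    unfolding gram S_def trace_weighted_gram_add_scaled weighted_gram_identity[OF fin(1)] ..
  have "t * \<tau> D \<le> 0" using t(1) D(2) by (simp add: mult_le_0_iff)
  then have "Re (trace (col_gram (I - {j}) V')) \<le> Re (trace (col_gram I V))"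
    using tr[of "mat 1"] by (simp add: \<tau>_def)
  moreover have "\<forall>e\<in>E. Re (trace (C e ** col_gram (I - {j}) V')) = Re (trace (C e ** col_gram I V))"
    using D(1) by (simp add: tr ker_def)
  moreover have "\<forall>g. (\<forall>s\<in>I - A. herm_prod g (V s) = 0) \<longrightarrow>
       (\<forall>i\<in>A. herm_prod g (V' i) = herm_prod g (V i)) \<and> (\<forall>i\<in>I - A - {j}. herm_prod g (V' i) = 0)"
  proof -
    have hp: "herm_prod g (V' i) = (if i \<in> A then herm_prod g (V i) else 0)"
      if g: "\<forall>s\<in>I - A. herm_prod g (V s) = 0" and i: "i \<in> I - {j}" for g i
    proof -
      have "herm_prod g (V' i) = (\<Sum>a\<in>UNIV. \<Sum>p\<in>I. s i p * (cnj (g $ a) * V p $ a))"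
        by (simp add: herm_prod_def V'_def sum_distrib_left mult.left_commute)
      also have "\<dots> = (\<Sum>p\<in>I. \<Sum>a\<in>UNIV. s i p * (cnj (g $ a) * V p $ a))" by (rule sum.swap)
      also have "\<dots> = (\<Sum>p\<in>I. s i p * herm_prod g (V p))" by (simp add: herm_prod_def sum_distrib_left)
      also have "\<dots> = (\<Sum>p\<in>A. s i p * herm_prod g (V p))"
        by (rule sum.mono_neutral_right) (use fin g in auto)
      also have "\<dots> = (\<Sum>p\<in>A. if p = i then herm_prod g (V p) else 0)"
        using s(2,3) i by (intro sum.cong refl) (cases "i \<in> A"; auto)
      also have "\<dots> = (if i \<in> A then herm_prod g (V i) else 0)" using finA by simp
      finally show ?thesis .
    qed
    have "i \<in> I - {j}" if "i \<in> A" for i using that fin(2) j by blast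
    then show ?thesis using hp by simp
  qed
  ultimately show ?thesis using j by blast
qed

section \<open>Symmetries of the line-of-sight information matrix\<close>

text \<open>Along a path-loss coordinate the angles are fixed and the channel is affine, so the
  derivative is its slope.\<close>

lemma partial_los_channel_Re:
  "partial (Inl i) (los_channel A) \<eta> = A (angle_of_arrival \<eta> i)"
proof -
  have "los_channel A (\<eta> + t *\<^sub>R axis (Inl i) 1) = los_channel A \<eta> + t *\<^sub>R A (angle_of_arrival \<eta> i)" for t
  proof -
    have p: "path_loss (\<eta> + t *\<^sub>R axis (Inl i) 1) k = path_loss \<eta> k + (if k = i then of_real t else 0)" for k
      by (auto simp: path_loss_def axis_def complex_eq_iff)
    have a: "angle_of_arrival (\<eta> + t *\<^sub>R axis (Inl i) 1) k = angle_of_arrival \<eta> k" for k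
      by (simp add: angle_of_arrival_def axis_def)
    show ?thesis
      by (simp add: vec_eq_iff los_channel_def p a distrib_right sum.distrib if_distrib[of "\<lambda>x. x * _"]
          scaleR_conv_of_real[where 'a=complex] cong: if_cong)
  qed
  then show ?thesis unfolding partial_def
    by (intro vector_derivative_at) (auto intro!: derivative_eq_intros)
qed

lemma partial_los_channel_Im:
  "partial (Inr (Inl i)) (los_channel A) \<eta> = (\<chi> a b. \<i> * A (angle_of_arrival \<eta> i) $ a $ b)"
proof -
  have "los_channel A (\<eta> + t *\<^sub>R axis (Inr (Inl i)) 1) =
    los_channel A \<eta> + t *\<^sub>R (\<chi> a b. \<i> * A (angle_of_arrival \<eta> i) $ a $ b)" for t
  proof -
    have p: "path_loss (\<eta> + t *\<^sub>R axis (Inr (Inl i)) 1) k = path_loss \<eta> k + (if k = i then of_real t * \<i> else 0)" for k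
      by (auto simp: path_loss_def axis_def complex_eq_iff)
    have a: "angle_of_arrival (\<eta> + t *\<^sub>R axis (Inr (Inl i)) 1) k = angle_of_arrival \<eta> k" for k
      by (simp add: angle_of_arrival_def axis_def)
    show ?thesis
      by (simp add: vec_eq_iff los_channel_def p a distrib_right sum.distrib if_distrib[of "\<lambda>x. x * _"]
          scaleR_conv_of_real[where 'a=complex] cong: if_cong)
  qed
  then show ?thesis unfolding partial_def
    by (intro vector_derivative_at) (auto intro!: derivative_eq_intros)
qed

lemma cross_gram_commute: "cross_gram G i j = cross_gram G j i"
  by (simp add: fun_eq_iff cross_gram_def add.commute)

text \<open>One factor \<open>\<i>\<close> enters conjugated and the other plain, and
  \<open>cnj \<i> * \<i> = 1\<close>.\<close>

lemma cross_gram_los_Im_Im: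
  "cross_gram (los_channel A) (Inr (Inl i)) (Inr (Inl j)) = cross_gram (los_channel A) (Inl i) (Inl j)"
  unfolding cross_gram_def fun_eq_iff partial_los_channel_Re partial_los_channel_Im
proof -
  have "\<i> * x * (\<i> * y) = - (x * y)" for x y by (simp add: complex_eq_iff)
  then show "\<forall>x. conj_transpose (\<chi> a b. \<i> * A (angle_of_arrival x i) $ a $ b) ** (\<chi> a b. \<i> * A (angle_of_arrival x j) $ a $ b) +
      conj_transpose (\<chi> a b. \<i> * A (angle_of_arrival x j) $ a $ b) ** (\<chi> a b. \<i> * A (angle_of_arrival x i) $ a $ b) =
      conj_transpose (A (angle_of_arrival x i)) ** A (angle_of_arrival x j) +
      conj_transpose (A (angle_of_arrival x j)) ** A (angle_of_arrival x i)"
    by (simp add: vec_eq_iff conj_transpose_def matrix_matrix_mult_def)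
qed

text \<open>With A_i the response of target i, the entry is \<open>\<i>\<close> times A_i^H A_j -
  A_j^H A_i, which is antisymmetric in i and j.\<close>

lemma cross_gram_los_Re_Im:
  "cross_gram (los_channel A) (Inl i) (Inr (Inl j)) = (\<lambda>x. - cross_gram (los_channel A) (Inl j) (Inr (Inl i)) x)"
  unfolding cross_gram_def fun_eq_iff partial_los_channel_Re partial_los_channel_Im
  by (simp add: vec_eq_iff conj_transpose_def matrix_matrix_mult_def sum_negf algebra_simps)

text \<open>The numbering \<open>e\<close> orders the targets, so that upper triangles make sense
  for any finite index type.\<close>

definition los_pairs :: "('tr \<Rightarrow> nat) \<Rightarrow> ('tr los \<times> 'tr los) set" where
  "los_pairs e =
     (\<lambda>(i, j). (Inl i, Inl j)) ` {(i, j). e i \<le> e j} \<union>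
     (\<lambda>(i, j). (Inl i, Inr (Inl j))) ` {(i, j). e i < e j} \<union>
     (\<lambda>(i, j). (Inl i, Inr (Inr j))) ` UNIV \<union>
     (\<lambda>(i, j). (Inr (Inl i), Inr (Inr j))) ` UNIV \<union>
     (\<lambda>(i, j). (Inr (Inr i), Inr (Inr j))) ` {(i, j). e i \<le> e j}"

text \<open>Two triangles with diagonal, one without and two full squares. The triangles satisfy
  \<open>card L + card M = card U\<close> and differ by the diagonal; doubling avoids
  fractions.\<close>

lemma card_los_pairs:
  fixes e :: "'tr::finite \<Rightarrow> nat"
  assumes "inj e"
  shows "finite (los_pairs e)" "2 * card (los_pairs e) \<le> 7 * CARD('tr)\<^sup>2 + CARD('tr)"
proof -
  define L where "L = {(i, j). e i \<le> e j}"
  define M where "M = {(i, j). e i < e j}"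
  define U where "U = (UNIV :: ('tr \<times> 'tr) set)"
  have U: "card U = CARD('tr)\<^sup>2"
    unfolding U_def by (subst UNIV_Times_UNIV[symmetric], subst card_cartesian_product) (simp add: power2_eq_square)
  have "card (prod.swap ` M) = card M" by (simp add: card_image)
  moreover have "U = L \<union> prod.swap ` M" "L \<inter> prod.swap ` M = {}"
    by (auto simp: U_def L_def M_def image_iff)
  ultimately have 1: "card L + card M = card U" by (simp add: card_Un_disjoint)
  have "L = M \<union> range (\<lambda>i. (i, i))" "M \<inter> range (\<lambda>i. (i, i)) = {}"
    using injD[OF assms] by (auto simp: L_def M_def le_less)
  then have "card L = card M + card (range (\<lambda>i::'tr. (i, i)))" by (simp add: card_Un_disjoint)
  also have "card (range (\<lambda>i::'tr. (i, i))) = CARD('tr)" by (intro card_image inj_onI) auto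
  finally have 2: "card L = card M + CARD('tr)" .
  have "card (los_pairs e) \<le> card L + card M + card U + card U + card L"
    unfolding los_pairs_def L_def[symmetric] M_def[symmetric] U_def[symmetric]
    by (intro order_trans[OF card_Un_le] add_mono card_image_le) auto
  then show "2 * card (los_pairs e) \<le> 7 * CARD('tr)\<^sup>2 + CARD('tr)" using 1 2 U by linarith
  show "finite (los_pairs e)" by simp
qed

text \<open>
  The blocks Re-Re and Im-Im coincide, and the block Re-Im is antisymmetric. So the upper triangles
  of Re-Re, Re-Im (strict) and angle-angle with the full blocks Re-angle and Im-angle suffice.
\<close>

lemma los_pairs_determine:
  fixes \<delta> :: "'tr::finite los \<Rightarrow> 'tr los \<Rightarrow> real"
  assumes "inj e" and sym: "\<And>i j. \<delta> i j = \<delta> j i"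
    and II: "\<And>i j. \<delta> (Inr (Inl i)) (Inr (Inl j)) = \<delta> (Inl i) (Inl j)"
    and RI: "\<And>i j. \<delta> (Inl i) (Inr (Inl j)) = - \<delta> (Inl j) (Inr (Inl i))"
    and zero: "\<And>i j. (i, j) \<in> los_pairs e \<Longrightarrow> \<delta> i j = 0"
  shows "\<delta> i j = 0"
proof -
  have RR: "\<delta> (Inl i) (Inl j) = 0" for i j
  proof (cases "e i \<le> e j")
    case True then show ?thesis by (intro zero) (auto simp: los_pairs_def)
  next
    case False then show ?thesis by (subst sym, intro zero) (auto simp: los_pairs_def)
  qed
  have TT: "\<delta> (Inr (Inr i)) (Inr (Inr j)) = 0" for i j
  proof (cases "e i \<le> e j")
    case True then show ?thesis by (intro zero) (auto simp: los_pairs_def)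
  next
    case False then show ?thesis by (subst sym, intro zero) (auto simp: los_pairs_def)
  qed
  have RI0: "\<delta> (Inl i) (Inr (Inl j)) = 0" for i j
  proof -
    consider "i = j" | "e i < e j" | "e j < e i" using injD[OF assms(1)] by (metis linorder_neqE_nat)
    then show ?thesis
    proof cases
      case 1 then show ?thesis using RI[of i i] by simp
    next
      case 2 then show ?thesis by (intro zero) (auto simp: los_pairs_def)
    next
      case 3
      then have "\<delta> (Inl j) (Inr (Inl i)) = 0" by (intro zero) (auto simp: los_pairs_def)
      then show ?thesis using RI[of i j] by simp
    qed
  qed
  have RT: "\<delta> (Inl i) (Inr (Inr j)) = 0" "\<delta> (Inr (Inl i)) (Inr (Inr j)) = 0" for i j
    by (intro zero; simp add: los_pairs_def image_iff)+
  obtain i' j' :: 'tr where "i = Inl i' \<or> i = Inr (Inl i') \<or> i = Inr (Inr i')" "j = Inl j' \<or> j = Inr (Inl j') \<or> j = Inr (Inr j')"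
    by (metis sum.exhaust)
  then show ?thesis
    using RR TT RI0 RT II sym[of "Inr (Inl i')" "Inl j'"] sym[of "Inr (Inr i')" "Inl j'"]
      sym[of "Inr (Inr i')" "Inr (Inl j')"] by (elim disjE) simp_all
qed

text \<open>The expected matrix paired with V V^H in an entry of the information matrix, indexed by
  pairs so that it can serve as the family \<open>C\<close> in \<open>remove_column\<close>.\<close>

definition mean_cross_gram ::
  "(real^'l \<Rightarrow> real) \<Rightarrow> (real^'l \<Rightarrow> complex^'nt^'nr) \<Rightarrow> 'l \<times> 'l \<Rightarrow> complex^'nt^'nt" where
  "mean_cross_gram f G p = (\<integral>x. cross_gram G (fst p) (snd p) x \<partial>prior f)"

text \<open>The prior term is the same on both sides, and the difference of the trace terms inherits
  the block symmetries of the cross Gram matrices.\<close>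

lemma bfim_los_eqI:
  fixes A :: "real \<Rightarrow> complex^'nt^'nr" and f :: "real^('tr::finite los) \<Rightarrow> real"
  assumes "inj e"
    and eq: "\<And>p. p \<in> los_pairs e \<Longrightarrow>
      Re (trace (mean_cross_gram f (los_channel A) p ** col_gram {..<N} V)) =
      Re (trace (mean_cross_gram f (los_channel A) p ** col_gram {..<N'} V'))"
  shows "bfim \<Upsilon> s2 f (los_channel A) N V = bfim \<Upsilon> s2 f (los_channel A) N' V'"
proof -
  define C where "C = (\<lambda>i j. mean_cross_gram f (los_channel A) (i, j))"
  have C: "C i j = C j i" "C (Inr (Inl k)) (Inr (Inl l)) = C (Inl k) (Inl l)"
    "C (Inl k) (Inr (Inl l)) = - C (Inl l) (Inr (Inl k))" for i j k l
    unfolding C_def mean_cross_gram_def fst_conv snd_conv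
    by (simp_all add: cross_gram_commute[of _ i j] cross_gram_los_Im_Im cross_gram_los_Re_Im[of _ k l])
  define \<delta> where "\<delta> = (\<lambda>i j. Re (trace (C i j ** col_gram {..<N} V)) - Re (trace (C i j ** col_gram {..<N'} V')))"
  have neg: "Re (trace (- X ** Y)) = - Re (trace (X ** Y))" for X Y :: "complex^'nt^'nt"
    by (simp add: trace_def matrix_matrix_mult_def sum_negf)
  have "\<delta> i j = 0" for i j
  proof (rule los_pairs_determine[OF assms(1)])
    show "\<delta> i j = \<delta> j i" for i j by (simp add: \<delta>_def C(1)[of i j])
    show "\<delta> (Inr (Inl i)) (Inr (Inl j)) = \<delta> (Inl i) (Inl j)" for i j by (simp add: \<delta>_def C(2))
    show "\<delta> (Inl i) (Inr (Inl j)) = - \<delta> (Inl j) (Inr (Inl i))" for i j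
      by (simp add: \<delta>_def C(3)[of i j] neg)
    show "\<delta> i j = 0" if "(i, j) \<in> los_pairs e" for i j using eq[OF that] by (simp add: \<delta>_def C_def)
  qed
  then show ?thesis by (simp add: bfim_def vec_eq_iff \<delta>_def C_def mean_cross_gram_def)
qed

section \<open>Making the sensing beams invisible to the users\<close>

lemma herm_prod_combination:
  "herm_prod g (\<chi> c. (p * x $ c + q * y $ c) / r) = (p * herm_prod g x + q * herm_prod g y) / r"
  by (simp add: herm_prod_def sum_divide_distrib sum_distrib_left sum.distrib[symmetric] algebra_simps add_divide_distrib)

lemma herm_prod_col_gram:
  "Re (herm_prod g (col_gram I V *v g)) = (\<Sum>i\<in>I. (cmod (herm_prod g (V i)))\<^sup>2)"
proof -
  have "herm_prod g (col_gram I V *v g) =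
     (\<Sum>a\<in>UNIV. \<Sum>b\<in>UNIV. \<Sum>i\<in>I. (cnj (g $ a) * V i $ a) * cnj (cnj (g $ b) * V i $ b))"
    by (simp add: herm_prod_def matrix_vector_mult_def col_gram_def sum_distrib_left sum_distrib_right mult_ac)
  also have "\<dots> = (\<Sum>a\<in>UNIV. \<Sum>i\<in>I. \<Sum>b\<in>UNIV. (cnj (g $ a) * V i $ a) * cnj (cnj (g $ b) * V i $ b))"
    by (intro sum.cong refl sum.swap)
  also have "\<dots> = (\<Sum>i\<in>I. \<Sum>a\<in>UNIV. \<Sum>b\<in>UNIV. (cnj (g $ a) * V i $ a) * cnj (cnj (g $ b) * V i $ b))"
    by (rule sum.swap)
  also have "\<dots> = (\<Sum>i\<in>I. herm_prod g (V i) * cnj (herm_prod g (V i)))"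
    by (simp only: herm_prod_def sum_product cnj_sum)
  also have "\<dots> = of_real (\<Sum>i\<in>I. (cmod (herm_prod g (V i)))\<^sup>2)"
    by (simp only: complex_norm_square[symmetric] of_real_sum)
  finally show ?thesis by simp
qed

lemma trace_col_gram: "Re (trace (col_gram I V)) = (\<Sum>i\<in>I. (norm (V i))\<^sup>2)"
proof -
  have "trace (col_gram I V) = (\<Sum>i\<in>I. \<Sum>a\<in>UNIV. V i $ a * cnj (V i $ a))"
    by (simp add: trace_def col_gram_def sum.swap[of _ I])
  also have "\<dots> = of_real (\<Sum>i\<in>I. (norm (V i))\<^sup>2)"
    by (simp add: norm_vec_def L2_set_def sum_nonneg complex_norm_square[symmetric] del: of_real_power)
  finally show ?thesis by simp
qed

text \<open>Columns \<open>k\<close> and \<open>s\<close> are multiplied by a unitary 2 by 2 matrix,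
  which cancels in the Gram matrix.\<close>

lemma col_gram_rotate:
  fixes U :: "nat \<Rightarrow> complex^'nt"
  assumes "finite I" "k \<in> I" "s \<in> I" "k \<noteq> s" and ab: "r\<^sup>2 = (cmod a)\<^sup>2 + (cmod b)\<^sup>2" "r \<noteq> 0"
  shows "col_gram I (U(k := \<chi> c. (cnj a * U k $ c + cnj b * U s $ c) / of_real r,
                       s := \<chi> c. ((- b) * U k $ c + a * U s $ c) / of_real r)) = col_gram I U"
    (is "col_gram I ?U = _")
proof -
  have split: "(\<Sum>i\<in>I. F i) = F k + F s + (\<Sum>i\<in>I - {k} - {s}. F i)" for F :: "nat \<Rightarrow> complex"
    using assms by (simp add: sum.remove[of I k] sum.remove[of "I - {k}" s])
  have r: "a * cnj a + b * cnj b = of_real r * of_real r"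
    using arg_cong[OF ab(1), of complex_of_real]
    by (simp add: complex_norm_square[symmetric] power2_eq_square)
  have "(\<Sum>i\<in>I. ?U i $ c * cnj (?U i $ d)) = (\<Sum>i\<in>I. U i $ c * cnj (U i $ d))" for c d
  proof -
    have "?U k $ c * cnj (?U k $ d) + ?U s $ c * cnj (?U s $ d) =
       (a * cnj a + b * cnj b) * (U k $ c * cnj (U k $ d) + U s $ c * cnj (U s $ d)) / (of_real r * of_real r)"
      using assms(4) by (simp add: add_divide_distrib[symmetric] diff_divide_distrib[symmetric] algebra_simps)
    also have "\<dots> = U k $ c * cnj (U k $ d) + U s $ c * cnj (U s $ d)"
      unfolding r using ab(2) by simp
    moreover have "(\<Sum>i\<in>I - {k} - {s}. ?U i $ c * cnj (?U i $ d)) = (\<Sum>i\<in>I - {k} - {s}. U i $ c * cnj (U i $ d))"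
      by (intro sum.cong) auto
    ultimately show ?thesis
      by (simp only: split[of "\<lambda>i. ?U i $ c * cnj (?U i $ d)"] split[of "\<lambda>i. U i $ c * cnj (U i $ d)"])
  qed
  then show ?thesis by (simp only: col_gram_def)
qed

text \<open>
  Among all matrices with the same Gram matrix take one maximizing the total useful signal. A rotation
  in the plane of \<open>V k\<close> and a sensing column \<open>V s\<close> that is visible to user \<open>k\<close>
  would increase the signal of user \<open>k\<close> and leave that of the others unchanged.
\<close>

lemma invisible_sensing_columns:
  fixes V H :: "nat \<Rightarrow> complex^'nt"
  assumes "K \<le> N"
  shows "\<exists>U. col_gram {..<N} U = col_gram {..<N} V \<and>
    (\<forall>k<K. cmod (herm_prod (H k) (V k)) \<le> cmod (herm_prod (H k) (U k))) \<and>
    (\<forall>k<K. \<forall>s\<in>{K..<N}. herm_prod (H k) (U s) = 0)"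
proof -
  define R where "R = sqrt (Re (trace (col_gram {..<N} V)))"
  \<comment> \<open>The Gram matrix bounds every column norm by \<open>R\<close>; columns from
    \<open>N\<close> on are set to zero for compactness.\<close>
  define box where "box = {U. \<forall>i. U i \<in> (if i < N then cball 0 R else {0 :: complex^'nt})}"
  define gain where "gain = (\<lambda>(U :: nat \<Rightarrow> complex^'nt) k. cmod (herm_prod (H k) (U k)))"
  \<comment> \<open>The last constraint prevents the maximization from trading the signal of one
    user for that of another.\<close>
  define cand where "cand = box \<inter> {U. col_gram {..<N} U = col_gram {..<N} V} \<inter>
     (\<Inter>k\<in>{..<K}. {U. gain V k \<le> gain U k})"
  have contc: "continuous_on UNIV (\<lambda>U :: nat \<Rightarrow> complex^'nt. U i $ a)" for i a
    by (intro continuous_on_component continuous_on_product_coordinates)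
  have cont: "continuous_on UNIV (\<lambda>U :: nat \<Rightarrow> complex^'nt. gain U k)" for k
    unfolding gain_def herm_prod_def by (intro continuous_intros contc)
  have "compact box" unfolding box_def by (rule compact_function_box) simp
  moreover have "{U. col_gram {..<N} U = col_gram {..<N} V} =
     (\<Inter>a\<in>UNIV. \<Inter>b\<in>UNIV. {U. (\<Sum>i<N. U i $ a * cnj (U i $ b)) = (\<Sum>i<N. V i $ a * cnj (V i $ b))})"
    by (auto simp: col_gram_def vec_eq_iff)
  moreover have "closed \<dots>"
    by (intro closed_INT ballI closed_Collect_eq continuous_intros contc)
  moreover have "closed (\<Inter>k\<in>{..<K}. {U. gain V k \<le> gain U k})"
    by (intro closed_INT ballI closed_Collect_le continuous_intros cont)
  ultimately have compact: "compact cand" unfolding cand_def by (intro compact_Int_closed) simp_all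
  have candI: "U \<in> cand" if "col_gram {..<N} U = col_gram {..<N} V" "\<And>k. k < K \<Longrightarrow> gain V k \<le> gain U k"
    "\<And>i. i \<ge> N \<Longrightarrow> U i = 0" for U
  proof -
    have "norm (U i) \<le> R" if "i < N" for i
    proof -
      have "(norm (U i))\<^sup>2 \<le> (\<Sum>i<N. (norm (U i))\<^sup>2)" using that by (intro member_le_sum) auto
      also have "\<dots> = Re (trace (col_gram {..<N} V))"
        using \<open>col_gram {..<N} U = _\<close> by (simp flip: trace_col_gram)
      finally show ?thesis by (simp add: R_def real_le_rsqrt)
    qed
    then show ?thesis using that by (auto simp: cand_def box_def)
  qed
  have "(\<lambda>i. if i < N then V i else 0) \<in> cand"
    using assms by (intro candI) (auto simp: col_gram_def gain_def)
  then have "cand \<noteq> {}" by blast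
  moreover have "continuous_on cand (\<lambda>U. \<Sum>k<K. (gain U k)\<^sup>2)"
    by (intro continuous_intros continuous_on_subset[OF cont]) auto
  ultimately obtain U where U: "U \<in> cand" "\<And>U'. U' \<in> cand \<Longrightarrow> (\<Sum>k<K. (gain U' k)\<^sup>2) \<le> (\<Sum>k<K. (gain U k)\<^sup>2)"
    using continuous_attains_sup[OF compact] by blast
  have "herm_prod (H k) (U s) = 0" if ks: "k < K" "s \<in> {K..<N}" for k s
  proof (rule ccontr)
    define a where "a = herm_prod (H k) (U k)"
    define b where "b = herm_prod (H k) (U s)"
    assume "herm_prod (H k) (U s) \<noteq> 0"
    then have b: "cmod b > 0" by (simp add: b_def)
    \<comment> \<open>The rotation gathers the signals \<open>a\<close> and \<open>b\<close> in
      column \<open>k\<close>, where user \<open>k\<close> then receives amplitude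
      \<open>r\<close>.\<close>
    define r where "r = sqrt ((cmod a)\<^sup>2 + (cmod b)\<^sup>2)"
    have r2: "r\<^sup>2 = (cmod a)\<^sup>2 + (cmod b)\<^sup>2" by (simp add: r_def)
    have r: "r > cmod a" "r > 0" unfolding r_def using b
      by (auto intro!: real_less_rsqrt add_nonneg_pos)
    define U' where "U' = U(k := \<chi> c. (cnj a * U k $ c + cnj b * U s $ c) / of_real r,
                            s := \<chi> c. ((- b) * U k $ c + a * U s $ c) / of_real r)"
    have gram: "col_gram {..<N} U' = col_gram {..<N} U"
      unfolding U'_def using ks r assms by (intro col_gram_rotate r2) auto
    have "herm_prod (H k) (U' k) = (cnj a * a + cnj b * b) / of_real r"
      using ks by (simp only: U'_def) (simp add: herm_prod_combination a_def b_def)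
    also have "\<dots> = of_real (r\<^sup>2) / of_real r" by (simp only: cnj_mult_self r2 of_real_add)
    also have "\<dots> = of_real r" using r by (simp add: power2_eq_square)
    finally have gk: "gain U' k = r" using r by (simp add: gain_def)
    \<comment> \<open>Column \<open>s\<close> is a sensing column, so the beams of the other users
      are untouched.\<close>
    have go: "gain U' l = gain U l" if "l < K" "l \<noteq> k" for l
      using that ks by (simp add: gain_def U'_def)
    have gU: "gain U k = cmod a" by (simp add: gain_def a_def)
    have le: "gain U l \<le> gain U' l" if "l < K" for l
      using that go[of l] gk gU r by (cases "l = k") auto
    have "U' \<in> cand"
    proof (rule candI)
      show "col_gram {..<N} U' = col_gram {..<N} V" using gram U(1) by (simp add: cand_def)
      show "gain V l \<le> gain U' l" if "l < K" for l
        using U(1) le[OF that] that by (force simp: cand_def)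
      show "U' i = 0" if "i \<ge> N" for i
      proof -
        have "U i = 0" using U(1) that by (auto simp: cand_def box_def dest: spec[of _ i])
        then show ?thesis using that ks assms by (auto simp: U'_def)
      qed
    qed
    moreover have "(\<Sum>k<K. (gain U k)\<^sup>2) < (\<Sum>k<K. (gain U' k)\<^sup>2)"
    proof (rule sum_strict_mono_ex1)
      show "\<forall>l\<in>{..<K}. (gain U l)\<^sup>2 \<le> (gain U' l)\<^sup>2"
        using le by (auto intro!: power_mono simp: gain_def)
      show "\<exists>l\<in>{..<K}. (gain U l)\<^sup>2 < (gain U' l)\<^sup>2"
        using ks gk gU r by (intro bexI[of _ k]) (auto intro!: power_strict_mono)
    qed simp
    ultimately show False using U(2) by force
  qed
  then show ?thesis using U(1) by (intro exI[of _ U]) (auto simp: cand_def gain_def)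
qed

section \<open>Feasible beamformers with one column fewer\<close>

text \<open>The last column fills the gap left by column \<open>j\<close>; for \<open>j = N\<close>
  nothing moves.\<close>

lemma col_gram_reindex:
  assumes "j \<le> N"
  shows "col_gram {..<N} (\<lambda>i. W (if i = j then N else i)) = col_gram ({..<Suc N} - {j}) W"
proof -
  have "bij_betw (\<lambda>i. if i = j then N else i) {..<N} ({..<Suc N} - {j})"
    by (rule bij_betw_byWitness[where f' = "\<lambda>i. if i = N then j else i"]) (use assms in auto)
  then have "(\<Sum>i<N. W (if i = j then N else i) $ a * cnj (W (if i = j then N else i) $ b)) =
      (\<Sum>i\<in>{..<Suc N} - {j}. W i $ a * cnj (W i $ b))" for a b
    by (rule sum.reindex_bij_betw)
  then show ?thesis by (simp only: col_gram_def)
qed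

lemma col_gram_cong: "(\<And>i. i \<in> I \<Longrightarrow> V i = W i) \<Longrightarrow> col_gram I V = col_gram I W"
  by (simp add: col_gram_def)

lemma col_gram_union:
  assumes "finite I" "finite J" "I \<inter> J = {}"
  shows "col_gram (I \<union> J) V = col_gram I V + col_gram J V"
  using assms by (simp add: col_gram_def vec_eq_iff sum.union_disjoint)

text \<open>Signal plus interference is the total received power, so only the Gram matrix and the
  user's own signal matter.\<close>

lemma sinr_NIC_eq:
  assumes "k < K" "K \<le> N"
  shows "sinr NIC H K s2 N V k = (cmod (herm_prod (H k) (V k)))\<^sup>2 /
    (Re (herm_prod (H k) (col_gram {..<N} V *v H k)) - (cmod (herm_prod (H k) (V k)))\<^sup>2 + s2)"
proof -
  let ?g = "\<lambda>i. (cmod (herm_prod (H k) (V i)))\<^sup>2"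
  have "{..<N} = {..<K} \<union> {K..<N}" using assms by auto
  then have "(\<Sum>i<N. ?g i) = (\<Sum>i<K. ?g i) + (\<Sum>i\<in>{K..<N}. ?g i)"
    by (simp add: sum.union_disjoint ivl_disj_int)
  moreover have "(\<Sum>i<K. ?g i) = ?g k + (\<Sum>i\<in>{..<K} - {k}. ?g i)"
    using assms by (simp add: sum.remove)
  ultimately show ?thesis by (simp add: herm_prod_col_gram)
qed

lemma sinr_NIC_mono:
  assumes "k < K" "K \<le> N" "s2 > 0" "col_gram {..<N} U = col_gram {..<N} V"
    "cmod (herm_prod (H k) (V k)) \<le> cmod (herm_prod (H k) (U k))"
  shows "sinr NIC H K s2 N V k \<le> sinr NIC H K s2 N U k"
proof -
  \<comment> \<open>Keeps the smaller denominator at least \<open>s2\<close>, hence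
    positive.\<close>
  have "(cmod (herm_prod (H k) (U k)))\<^sup>2 \<le> Re (herm_prod (H k) (col_gram {..<N} U *v H k))"
    unfolding herm_prod_col_gram using assms by (intro member_le_sum) auto
  then show ?thesis
    unfolding sinr_NIC_eq[OF assms(1,2)] using assms
    by (intro frac_le) (auto intro!: power_mono diff_left_mono)
qed

lemma sinr_NIC_invisible:
  assumes "\<forall>s\<in>{K..<N}. herm_prod (H k) (V s) = 0"
  shows "sinr NIC H K s2 N V k = sinr IC H K s2 N V k"
  using assms by (simp add: herm_prod_col_gram)

lemma sinr_IC_cong:
  assumes "\<And>i. i < K \<Longrightarrow> herm_prod (H k) (V i) = herm_prod (H k) (W i)" "k < K"
  shows "sinr IC H K s2 N V k = sinr IC H K s2 N' W k"
  using assms by simp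

text \<open>The reduction runs on the sensing columns alone, with \<open>A = {}\<close>. The users
  see only the communication columns, which are kept.\<close>

lemma feasible_remove_column_IC:
  assumes V: "V \<in> feasible IC H K s2 \<gamma> P (Suc N)" and "K \<le> N"
    and E: "finite E" "card E < (Suc N - K)\<^sup>2"
  shows "\<exists>U \<in> feasible IC H K s2 \<gamma> P N.
    \<forall>e\<in>E. Re (trace (C e ** col_gram {..<N} U)) = Re (trace (C e ** col_gram {..<Suc N} V))"
proof -
  obtain j V' where j: "j \<in> {K..<Suc N}"
    and eq: "\<forall>e\<in>E. Re (trace (C e ** col_gram ({K..<Suc N} - {j}) V')) = Re (trace (C e ** col_gram {K..<Suc N} V))"
    and le: "Re (trace (col_gram ({K..<Suc N} - {j}) V')) \<le> Re (trace (col_gram {K..<Suc N} V))"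
    using remove_column[of "{K..<Suc N}" "{}" E C V] E by auto
  \<comment> \<open>Communication columns from \<open>V\<close>, sensing columns from the reduction;
    \<open>U\<close> then closes the gap at \<open>j\<close>, which is a sensing index.\<close>
  define W where "W = (\<lambda>i. if i < K then V i else V' i)"
  define U where "U = (\<lambda>i. W (if i = j then N else i))"
  have "col_gram {..<N} U = col_gram ({..<Suc N} - {j}) W"
    unfolding U_def using j by (intro col_gram_reindex) simp
  also have "{..<Suc N} - {j} = {..<K} \<union> ({K..<Suc N} - {j})" using j by auto
  also have "col_gram \<dots> W = col_gram {..<K} W + col_gram ({K..<Suc N} - {j}) W"
    by (rule col_gram_union) auto
  also have "col_gram {..<K} W = col_gram {..<K} V" by (rule col_gram_cong) (simp add: W_def)
  also have "col_gram ({K..<Suc N} - {j}) W = col_gram ({K..<Suc N} - {j}) V'"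
    by (rule col_gram_cong) (auto simp: W_def)
  finally have U: "col_gram {..<N} U = col_gram {..<K} V + col_gram ({K..<Suc N} - {j}) V'" .
  have "{..<Suc N} = {..<K} \<union> {K..<Suc N}" using \<open>K \<le> N\<close> by auto
  then have VV: "col_gram {..<Suc N} V = col_gram {..<K} V + col_gram {K..<Suc N} V"
    using col_gram_union[of "{..<K}" "{K..<Suc N}" V] by (simp add: ivl_disj_int)
  have "sinr IC H K s2 N U k = sinr IC H K s2 (Suc N) V k" if "k < K" for k
    using that j by (intro sinr_IC_cong) (auto simp: U_def W_def)
  then have "U \<in> feasible IC H K s2 \<gamma> P N"
    using V le by (simp add: feasible_def U VV trace_add del: sinr.simps)
  moreover have "\<forall>e\<in>E. Re (trace (C e ** col_gram {..<N} U)) = Re (trace (C e ** col_gram {..<Suc N} V))"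
    using eq by (simp add: U VV matrix_add_ldistrib trace_add)
  ultimately show ?thesis by blast
qed

text \<open>With the sensing columns invisible, \<open>remove_column\<close> with the communication
  columns as \<open>A\<close> preserves every received signal.\<close>

lemma feasible_remove_column_NIC:
  assumes V: "V \<in> feasible NIC H K s2 \<gamma> P (Suc N)" and "K \<le> N" "s2 > 0"
    and E: "finite E" "card E + K\<^sup>2 < (Suc N)\<^sup>2"
  shows "\<exists>U \<in> feasible NIC H K s2 \<gamma> P N.
    \<forall>e\<in>E. Re (trace (C e ** col_gram {..<N} U)) = Re (trace (C e ** col_gram {..<Suc N} V))"
proof -
  have KN: "K \<le> Suc N" using \<open>K \<le> N\<close> by simp
  obtain V1 where V1: "col_gram {..<Suc N} V1 = col_gram {..<Suc N} V"
    "\<forall>k<K. cmod (herm_prod (H k) (V k)) \<le> cmod (herm_prod (H k) (V1 k))"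
    "\<forall>k<K. \<forall>s\<in>{K..<Suc N}. herm_prod (H k) (V1 s) = 0"
    using invisible_sensing_columns[OF KN] by blast
  have I: "{..<Suc N} - {..<K} = {K..<Suc N}" by auto
  obtain j V' where j: "j \<in> {K..<Suc N}"
    and eq: "\<forall>e\<in>E. Re (trace (C e ** col_gram ({..<Suc N} - {j}) V')) = Re (trace (C e ** col_gram {..<Suc N} V1))"
    and le: "Re (trace (col_gram ({..<Suc N} - {j}) V')) \<le> Re (trace (col_gram {..<Suc N} V1))"
    and inv: "\<forall>g. (\<forall>s\<in>{K..<Suc N}. herm_prod g (V1 s) = 0) \<longrightarrow>
       (\<forall>i\<in>{..<K}. herm_prod g (V' i) = herm_prod g (V1 i)) \<and> (\<forall>i\<in>{K..<Suc N} - {j}. herm_prod g (V' i) = 0)"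
    using remove_column[of "{..<Suc N}" "{..<K}" E C V1] E KN unfolding I by auto
  define U where "U = (\<lambda>i. V' (if i = j then N else i))"
  have gram: "col_gram {..<N} U = col_gram ({..<Suc N} - {j}) V'"
    unfolding U_def using j by (intro col_gram_reindex) auto
  have "\<gamma> k \<le> sinr NIC H K s2 N U k" if k: "k < K" for k
  proof -
    have V'k: "\<forall>i\<in>{..<K}. herm_prod (H k) (V' i) = herm_prod (H k) (V1 i)"
        "\<forall>i\<in>{K..<Suc N} - {j}. herm_prod (H k) (V' i) = 0"
      using inv V1(3) k by blast+
    \<comment> \<open>Sensing columns are invisible before and after the removal, so both SINRs
      reduce to the one with cancellation.\<close>
    have "\<forall>s\<in>{K..<N}. herm_prod (H k) (U s) = 0" using V'k(2) by (auto simp: U_def)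
    then have "sinr NIC H K s2 N U k = sinr IC H K s2 N U k" by (rule sinr_NIC_invisible)
    also have "\<dots> = sinr IC H K s2 (Suc N) V1 k"
      using V'k(1) k j by (intro sinr_IC_cong) (auto simp: U_def)
    also have "\<dots> = sinr NIC H K s2 (Suc N) V1 k"
      using V1(3) k by (intro sinr_NIC_invisible[symmetric]) blast
    also have "\<dots> \<ge> sinr NIC H K s2 (Suc N) V k"
      using V1 k KN \<open>s2 > 0\<close> by (intro sinr_NIC_mono) auto
    finally show ?thesis using V k by (auto simp: feasible_def)
  qed
  then have "U \<in> feasible NIC H K s2 \<gamma> P N"
    using V le by (simp add: feasible_def gram V1(1) del: sinr.simps)
  then show ?thesis using eq by (intro bexI[of _ U]) (simp_all add: gram V1(1))
qed

lemma feasible_pad: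
  assumes V: "V \<in> feasible m H K s2 \<gamma> P N" and "K \<le> N"
  shows "V(N := 0) \<in> feasible m H K s2 \<gamma> P (Suc N)" "col_gram {..<Suc N} (V(N := 0)) = col_gram {..<N} V"
proof -
  show gram: "col_gram {..<Suc N} (V(N := 0)) = col_gram {..<N} V"
    by (simp add: col_gram_def)
  have "sinr m H K s2 (Suc N) (V(N := 0)) k = sinr m H K s2 N V k" if "k < K" for k
  proof (cases m)
    case IC
    then show ?thesis using that \<open>K \<le> N\<close> by simp
  next
    case NIC
    have "(V(N := 0)) k = V k" using that \<open>K \<le> N\<close> by simp
    then show ?thesis
      using that \<open>K \<le> N\<close> by (simp only: NIC sinr_NIC_eq le_SucI gram)
  qed
  then show "V(N := 0) \<in> feasible m H K s2 \<gamma> P (Suc N)"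
    using V by (simp add: feasible_def gram del: sinr.simps)
qed

section \<open>The minimum number of beamformers\<close>

text \<open>The objective depends on the beamformers only through the information matrix, so every
  value reached with \<open>N\<close> columns is reached with \<open>N'\<close>.\<close>

lemma opt_value_mono:
  assumes "\<And>V. V \<in> feasible m H K s2 \<gamma> P N \<Longrightarrow>
    \<exists>U \<in> feasible m H K s2 \<gamma> P N'. bfim \<Upsilon> s2 f G N' U = bfim \<Upsilon> s2 f G N V"
  shows "opt_value m H K s2 \<gamma> P \<Upsilon> f G h N' \<le> opt_value m H K s2 \<gamma> P \<Upsilon> f G h N"
  unfolding opt_value_def
proof (rule INF_greatest)
  fix V assume "V \<in> feasible m H K s2 \<gamma> P N"
  then obtain U where "U \<in> feasible m H K s2 \<gamma> P N'" "bfim \<Upsilon> s2 f G N' U = bfim \<Upsilon> s2 f G N V"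
    using assms by blast
  then show "(INF V\<in>feasible m H K s2 \<gamma> P N'. objective h (bfim \<Upsilon> s2 f G N' V)) \<le> objective h (bfim \<Upsilon> s2 f G N V)"
    by (metis INF_lower)
qed

text \<open>Padding by a zero column and the hypothesis \<open>step\<close> make the optimal value
  constant from \<open>n\<close> on.\<close>

lemma min_beamformers_le:
  fixes H :: "nat \<Rightarrow> complex^'nt"
  assumes "K \<le> n"
    and step: "\<And>N V. n \<le> N \<Longrightarrow> V \<in> feasible m H K s2 \<gamma> P (Suc N) \<Longrightarrow>
      \<exists>U \<in> feasible m H K s2 \<gamma> P N. bfim \<Upsilon> s2 f G N U = bfim \<Upsilon> s2 f G (Suc N) V"
  shows "min_beamformers m H K s2 \<gamma> P \<Upsilon> f G h \<le> n"
proof -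
  let ?opt = "opt_value m H K s2 \<gamma> P \<Upsilon> f G h"
  have Suc: "?opt (Suc N) = ?opt N" if "n \<le> N" for N
  proof (rule antisym)
    have "K \<le> N" using that \<open>K \<le> n\<close> by simp
    show "?opt (Suc N) \<le> ?opt N"
    proof (rule opt_value_mono)
      fix V assume "V \<in> feasible m H K s2 \<gamma> P N"
      from feasible_pad[OF this \<open>K \<le> N\<close>]
      show "\<exists>U \<in> feasible m H K s2 \<gamma> P (Suc N). bfim \<Upsilon> s2 f G (Suc N) U = bfim \<Upsilon> s2 f G N V"
        by (intro bexI[of _ "V(N := 0)"]) (simp_all only: bfim_def)
    qed
    show "?opt N \<le> ?opt (Suc N)" using step that by (intro opt_value_mono) blast
  qed
  have const: "?opt N = ?opt n" if "n \<le> N" for N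
    using that by (induction N rule: dec_induct) (auto simp: Suc)
  show ?thesis
  proof (cases "n \<le> CARD('nt) + K")
    case True
    then show ?thesis unfolding min_beamformers_def using const[OF True] \<open>K \<le> n\<close>
      by (intro Least_le) simp
  next
    \<comment> \<open>Here the reference number of columns lies below \<open>n\<close> and is itself
      an upper bound for the minimum.\<close>
    case False
    have "min_beamformers m H K s2 \<gamma> P \<Upsilon> f G h \<le> CARD('nt) + K"
      unfolding min_beamformers_def by (intro Least_le) simp
    then show ?thesis using False by simp
  qed
qed

text \<open>The reference number itself satisfies the predicate under \<open>LEAST\<close>, so the
  least element does too.\<close>

lemma min_beamformers_ge:
  fixes H :: "nat \<Rightarrow> complex^'nt"
  shows "K \<le> min_beamformers m H K s2 \<gamma> P \<Upsilon> f G h"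
  unfolding min_beamformers_def 
  by (rule LeastI2_ex, rule exI[of _ "CARD('nt) + K"]) auto

lemma min_beamformers_los_IC:
  fixes A :: "real \<Rightarrow> complex^'nt^'nr" and f :: "real^('tr::finite los) \<Rightarrow> real"
  shows "int (min_beamformers IC H K s2 \<gamma> P \<Upsilon> f (los_channel A) h) \<le>
    int K + \<lfloor>sqrt (7/2 * (real CARD('tr))\<^sup>2 + 1/2 * real CARD('tr))\<rfloor>"
proof -
  define M where "M = 7/2 * (real CARD('tr))\<^sup>2 + 1/2 * real CARD('tr)"
  obtain e :: "'tr \<Rightarrow> nat" where e: "inj e" using finite_imp_inj_to_nat_seg[of "UNIV :: 'tr set"] by auto
  have M: "real (card (los_pairs e)) \<le> M"
    using of_nat_mono[OF card_los_pairs(2)[OF e], where 'a=real] by (simp add: M_def)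
  define n where "n = K + nat \<lfloor>sqrt M\<rfloor>"
  have "min_beamformers IC H K s2 \<gamma> P \<Upsilon> f (los_channel A) h \<le> n"
  proof (rule min_beamformers_le)
    fix N and V :: "nat \<Rightarrow> complex^'nt"
    assume N: "n \<le> N" and V: "V \<in> feasible IC H K s2 \<gamma> P (Suc N)"
    have KN: "K \<le> N" using N by (simp add: n_def)
    \<comment> \<open>\<open>N\<close> is at least \<open>K\<close> plus the floor of
      \<open>sqrt M\<close>, so one more column exceeds \<open>sqrt M\<close> strictly and the
      dimension count applies.\<close>
    have "sqrt M < real (Suc N - K)" using N KN unfolding n_def by linarith
    then have "M < (real (Suc N - K))\<^sup>2" using real_less_lsqrt real_sqrt_less_iff
      by (metis real_sqrt_abs abs_of_nat)
    then have "real (card (los_pairs e)) < real ((Suc N - K)\<^sup>2)"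
      unfolding of_nat_power using M by linarith
    then have "card (los_pairs e) < (Suc N - K)\<^sup>2" by (simp only: of_nat_less_iff)
    from feasible_remove_column_IC[OF V KN card_los_pairs(1)[OF e] this, where C = "mean_cross_gram f (los_channel A)"]
    obtain U where U: "U \<in> feasible IC H K s2 \<gamma> P N"
      "\<forall>p\<in>los_pairs e. Re (trace (mean_cross_gram f (los_channel A) p ** col_gram {..<N} U)) =
         Re (trace (mean_cross_gram f (los_channel A) p ** col_gram {..<Suc N} V))" by (elim bexE)
    have "bfim \<Upsilon> s2 f (los_channel A) N U = bfim \<Upsilon> s2 f (los_channel A) (Suc N) V"
      using U(2) by (intro bfim_los_eqI[OF e]) blast
    with U(1) show "\<exists>U\<in>feasible IC H K s2 \<gamma> P N. bfim \<Upsilon> s2 f (los_channel A) N U = bfim \<Upsilon> s2 f (los_channel A) (Suc N) V"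
      by blast
  qed (simp add: n_def)
  moreover have "0 \<le> sqrt M" using M by (intro real_sqrt_ge_zero) linarith
  ultimately show ?thesis unfolding M_def[symmetric] n_def by linarith
qed

lemma min_beamformers_los_NIC:
  fixes A :: "real \<Rightarrow> complex^'nt^'nr" and f :: "real^('tr::finite los) \<Rightarrow> real"
  assumes "s2 > 0"
  shows "int (min_beamformers NIC H K s2 \<gamma> P \<Upsilon> f (los_channel A) h) \<le>
    \<lfloor>sqrt ((real K)\<^sup>2 + 7/2 * (real CARD('tr))\<^sup>2 + 1/2 * real CARD('tr))\<rfloor>"
proof -
  define M where "M = (real K)\<^sup>2 + 7/2 * (real CARD('tr))\<^sup>2 + 1/2 * real CARD('tr)"
  obtain e :: "'tr \<Rightarrow> nat" where e: "inj e" using finite_imp_inj_to_nat_seg[of "UNIV :: 'tr set"] by auto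
  have M: "real (card (los_pairs e)) + (real K)\<^sup>2 \<le> M"
    using of_nat_mono[OF card_los_pairs(2)[OF e], where 'a=real] by (simp add: M_def)
  \<comment> \<open>Ensures \<open>K \<le> n\<close>, which \<open>min_beamformers_le\<close>
    requires.\<close>
  have "real K \<le> sqrt M" using M by (intro real_le_rsqrt) linarith
  define n where "n = nat \<lfloor>sqrt M\<rfloor>"
  have Kn: "K \<le> n" using \<open>real K \<le> sqrt M\<close> unfolding n_def by linarith
  have "min_beamformers NIC H K s2 \<gamma> P \<Upsilon> f (los_channel A) h \<le> n"
  proof (rule min_beamformers_le[OF Kn])
    fix N and V :: "nat \<Rightarrow> complex^'nt"
    assume N: "n \<le> N" and V: "V \<in> feasible NIC H K s2 \<gamma> P (Suc N)"
    have KN: "K \<le> N" using N Kn by simp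
    have "sqrt M < real (Suc N)" using N unfolding n_def by linarith
    then have "M < (real (Suc N))\<^sup>2" by (metis real_sqrt_less_iff real_sqrt_abs abs_of_nat)
    then have "real (card (los_pairs e) + K\<^sup>2) < real ((Suc N)\<^sup>2)"
      using M by simp
    then have "card (los_pairs e) + K\<^sup>2 < (Suc N)\<^sup>2" by (simp only: of_nat_less_iff)
    from feasible_remove_column_NIC[OF V KN assms card_los_pairs(1)[OF e] this, where C = "mean_cross_gram f (los_channel A)"]
    obtain U where U: "U \<in> feasible NIC H K s2 \<gamma> P N"
      "\<forall>p\<in>los_pairs e. Re (trace (mean_cross_gram f (los_channel A) p ** col_gram {..<N} U)) =
         Re (trace (mean_cross_gram f (los_channel A) p ** col_gram {..<Suc N} V))" by (elim bexE)
    have "bfim \<Upsilon> s2 f (los_channel A) N U = bfim \<Upsilon> s2 f (los_channel A) (Suc N) V"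
      using U(2) by (intro bfim_los_eqI[OF e]) blast
    with U(1) show "\<exists>U\<in>feasible NIC H K s2 \<gamma> P N. bfim \<Upsilon> s2 f (los_channel A) N U = bfim \<Upsilon> s2 f (los_channel A) (Suc N) V"
      by blast
  qed
  moreover have "0 \<le> sqrt M" using \<open>real K \<le> sqrt M\<close> by linarith
  ultimately show ?thesis unfolding M_def[symmetric] n_def by linarith
qed

theorem mainTheorem4:
  fixes A :: "real \<Rightarrow> complex^'nt^'nr"
    and f :: "real^('tr::finite los) \<Rightarrow> real"
    and H :: "nat \<Rightarrow> complex^'nt"
    and h :: "real^('tr los)^('tr los) \<Rightarrow> real"
    and \<gamma> :: "nat \<Rightarrow> real"
    and s2 P :: real
    and \<Upsilon> K :: nat
  assumes "\<Upsilon> \<ge> 1" and "s2 > 0" and "P > 0"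
    and "\<forall>t. A differentiable (at t)"
    and "f \<in> borel_measurable borel" and "\<forall>x. f x \<ge> 0" and "prob_space (prior f)"
    and "bfim_expectations_exist f (los_channel A)"
    and "monotone_on {M. psd M} loewner_le (\<le>) h"
    and "\<forall>k<K. \<gamma> k > 0"
    and "\<forall>m. \<forall>N\<ge>K. strictly_feasible m H K s2 \<gamma> P N"
  shows
    "let Ntr = real CARD('tr);
         Nmin = (\<lambda>m. min_beamformers m H K s2 \<gamma> P \<Upsilon> f (los_channel A) h)
     in int (Nmin IC) \<le> int K + \<lfloor>sqrt (7/2 * Ntr\<^sup>2 + 1/2 * Ntr)\<rfloor> \<and>
        int (Nmin NIC) \<le> \<lfloor>sqrt ((real K)\<^sup>2 + 7/2 * Ntr\<^sup>2 + 1/2 * Ntr)\<rfloor> \<and>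
        (K = 0 \<longrightarrow>
           int (Nmin IC) \<le> \<lfloor>sqrt (7/2 * Ntr\<^sup>2 + 1/2 * Ntr)\<rfloor> \<and>
           int (Nmin NIC) \<le> \<lfloor>sqrt (7/2 * Ntr\<^sup>2 + 1/2 * Ntr)\<rfloor>) \<and>
        (real K \<ge> 7/4 * Ntr\<^sup>2 + 1/4 * Ntr \<longrightarrow> Nmin NIC = K)"
proof -
  define N where "N = real CARD('tr)"
  define Nmin where "Nmin = (\<lambda>m. min_beamformers m H K s2 \<gamma> P \<Upsilon> f (los_channel A) h)"
  have IC: "int (Nmin IC) \<le> int K + \<lfloor>sqrt (7/2 * N\<^sup>2 + 1/2 * N)\<rfloor>"
    unfolding Nmin_def N_def by (rule min_beamformers_los_IC)
  have NIC: "int (Nmin NIC) \<le> \<lfloor>sqrt ((real K)\<^sup>2 + 7/2 * N\<^sup>2 + 1/2 * N)\<rfloor>"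
    unfolding Nmin_def N_def using \<open>s2 > 0\<close> by (rule min_beamformers_los_NIC)
  have "Nmin NIC = K" if "real K \<ge> 7/4 * N\<^sup>2 + 1/4 * N"
  proof -
    \<comment> \<open>The assumption bounds the last two terms by \<open>2 * K\<close>, one less
      than \<open>(K + 1)\<^sup>2 - K\<^sup>2\<close>; hence the floor is at most
      \<open>K\<close>.\<close>
    have "(real K)\<^sup>2 + 7/2 * N\<^sup>2 + 1/2 * N < (real K + 1)\<^sup>2"
      using that by (simp add: power2_eq_square algebra_simps)
    then have "sqrt ((real K)\<^sup>2 + 7/2 * N\<^sup>2 + 1/2 * N) < real K + 1"
      by (intro real_less_lsqrt) auto
    then have "int (Nmin NIC) < int K + 1" using NIC by linarith
    moreover have "K \<le> Nmin NIC" unfolding Nmin_def by (rule min_beamformers_ge)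
    ultimately show ?thesis by linarith
  qed
  then show ?thesis
    using IC NIC unfolding Let_def Nmin_def[symmetric] N_def[symmetric] by auto
qed

end
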